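(* Let $(X_n)_{n\in\mathbb{N}}$ be a strictly stationary sequence with extremal index $\theta\in(0,1]$ and let $(u_r)_{r\in\mathbb{N}}$ be a (deterministic) sequence of thresholds such that $r\bar F(u_r)\to\tau\in(0,\infty)$ as $r\to\infty$. Let $(r_n)$ and $(l_n)$ be positive integer sequences such that, as $n\to\infty$, $$l_n=o(r_n),\qquad r_n=o(n),\qquad \sum_{l=l_n}^{n}\rho_{n,l}(u_{r_n})=o(r_n).$$ Suppose there exist a positive integer sequence $(s_n)_{n\in\mathbb{N}}$ and a probability distribution $(\pi_j)_{j\in\mathbb{N}}$ on the positive integers such that, as $n\to\infty$, $$l_n=o(s_n),\qquad s_n=o(r_n),\qquad \rho_{n,l_n}(u_{r_n})=o(s_n/n),$$ $$\Pr\{N_{s_n}(u_{r_n})=j\mid M_{s_n}>u_{r_n}\}\to\pi_j\quad\text{for all }j\in\mathbb{N},$$ $$\mathrm{E}[N_{s_n}^2(u_{r_n})\mid M_{s_n}>u_{r_n}]\to\sum_{j=1}^{\infty}j^2\pi_j<\infty.$$ Then, as $n\to\infty$, $$\hat\theta^{\mathrm{dj}}_{n,r_n}(u_{r_n})\xrightarrow{p}\theta\qquad\text{and}\qquad\hat\theta^{\mathrm{sl}}_{n,r_n}(u_{r_n})\xrightarrow{p}\theta,$$ where $\xrightarrow{p}$ denotes convergence in probability.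
   Context: $(X_n)_{n\in\mathbb{N}}$, $\mathbb{N}=\{1,2,\dots\}$, is a strictly stationary sequence of real random variables with marginal distribution function $F$, and $\bar F=1-F$. Extremal index: the sequence has extremal index $\theta\in(0,1]$ if for each $\tau>0$ there exists a sequence of levels $(u_n(\tau))_{n\in\mathbb{N}}$ such that $\lim_{n\to\infty}n\bar F(u_n(\tau))=\tau$ and $\lim_{n\to\infty}\Pr(M_n\le u_n(\tau))=e^{-\theta\tau}$, where $M_n=\max\{X_1,\dots,X_n\}$. For a positive integer $s$ and a threshold $u$, $N_s(u)=\sum_{i=1}^{s}I(X_i>u)$. For integers $0\le s<r$, $M_{s,r}=\max_{s<i\le r}X_i$. For integers $1\le r\le n$, with $k=\lfloor n/r\rfloor$, $$\hat F^{\mathrm{dj}}_{n,r}(u)=\frac1k\sum_{i=1}^{k}I(M_{(i-1)r,ir}\le u),\quad \hat F^{\mathrm{sl}}_{n,r}(u)=\frac1{n-r+1}\sum_{i=0}^{n-r}I(M_{i,i+r}\le u),\quad \hat\tau_{n,r}(u)=\frac1k\sum_{i=1}^{rk}I(X_i>u).$$ The disjoint and sliding blocks estimators of the extremal index are $$\hat\theta^{\mathrm{dj}}_{n,r}(u)=-\frac{\log\hat F^{\mathrm{dj}}_{n,r}(u)}{\hat\tau_{n,r}(u)},\qquad \hat\theta^{\mathrm{sl}}_{n,r}(u)=-\frac{\log\hat F^{\mathrm{sl}}_{n,r}(u)}{\hat\tau_{n,r}(u)},$$ with an arbitrary fixed value assigned on the event where the expression is undefined. Maximal correlation coefficients relative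 to the threshold $u$: $$\rho_{n,l}(u)=\max_{t=1,\dots,n-l}\ \sup\bigl\{|\operatorname{corr}(\xi,\eta)|:\ \xi\in L_2(\mathcal F_{1,t}(u)),\ \eta\in L_2(\mathcal F_{t+l,n}(u))\bigr\},$$ where $\mathcal F_{a,b}(u)$ is the $\sigma$-field generated by the events $\{X_i\le u\}$, $i\in\{a,\dots,b\}$, $L_2(\mathcal F)$ is the space of $\mathcal F$-measurable square-integrable random variables, and $\xi,\eta$ are required to have positive variance. A maximum or supremum over an empty set is $0$ (in particular $\rho_{n,n}(u)=0$). *)

theory Defs
  imports "HOL-Probability.Probability" "HOL-Library.Landau_Symbols"
begin

text \<open>
  A random sequence indexed by the positive integers is a function
  \<open>X :: nat \<Rightarrow> 'a \<Rightarrow> real\<close> of which only the values at indices \<open>i \<ge> 1\<close> are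
  ever used; \<open>X 0\<close> is unconstrained.
\<close>

definition strictly_stationary :: "'a measure \<Rightarrow> (nat \<Rightarrow> 'a \<Rightarrow> real) \<Rightarrow> bool" where
  "strictly_stationary M X \<longleftrightarrow>
     (\<forall>i\<ge>1. X i \<in> borel_measurable M) \<and>
     (\<forall>J h. finite J \<and> J \<subseteq> {1..} \<longrightarrow>
        distr M (Pi\<^sub>M J (\<lambda>_. borel)) (\<lambda>\<omega>. \<lambda>i\<in>J. X (i + h) \<omega>) =
        distr M (Pi\<^sub>M J (\<lambda>_. borel)) (\<lambda>\<omega>. \<lambda>i\<in>J. X i \<omega>))"

definition marginal_tail :: "'a measure \<Rightarrow> (nat \<Rightarrow> 'a \<Rightarrow> real) \<Rightarrow> real \<Rightarrow> real" where
  "marginal_tail M X u = 1 - cdf (distr M borel (X 1)) u"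

text \<open>\<open>M\<^bsub>s,r\<^esub>\<close>, for \<open>s < r\<close>; the partial maximum \<open>M\<^sub>n\<close> is \<open>block_max X 0 n\<close>.\<close>

definition block_max :: "(nat \<Rightarrow> 'a \<Rightarrow> real) \<Rightarrow> nat \<Rightarrow> nat \<Rightarrow> 'a \<Rightarrow> real" where
  "block_max X s r \<omega> = Max ((\<lambda>i. X i \<omega>) ` {s<..r})"

definition exceedances :: "(nat \<Rightarrow> 'a \<Rightarrow> real) \<Rightarrow> nat \<Rightarrow> real \<Rightarrow> 'a \<Rightarrow> nat" where
  "exceedances X s u \<omega> = (\<Sum>i=1..s. of_bool (X i \<omega> > u))"

definition has_extremal_index :: "'a measure \<Rightarrow> (nat \<Rightarrow> 'a \<Rightarrow> real) \<Rightarrow> real \<Rightarrow> bool" where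
  "has_extremal_index M X \<theta> \<longleftrightarrow> 0 < \<theta> \<and> \<theta> \<le> 1 \<and>
     (\<forall>\<tau>>0. \<exists>v :: nat \<Rightarrow> real.
        (\<lambda>n. real n * marginal_tail M X (v n)) \<longlonglongrightarrow> \<tau> \<and>
        (\<lambda>n. \<P>(\<omega> in M. block_max X 0 n \<omega> \<le> v n)) \<longlonglongrightarrow> exp (- \<theta> * \<tau>))"

text \<open>The following are meant for \<open>1 \<le> r \<le> n\<close> only.\<close>

definition F_dj :: "(nat \<Rightarrow> 'a \<Rightarrow> real) \<Rightarrow> nat \<Rightarrow> nat \<Rightarrow> real \<Rightarrow> 'a \<Rightarrow> real" where
  "F_dj X n r u \<omega> =
     (\<Sum>i=1..n div r. of_bool (block_max X ((i - 1) * r) (i * r) \<omega> \<le> u)) / real (n div r)"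

definition F_sl :: "(nat \<Rightarrow> 'a \<Rightarrow> real) \<Rightarrow> nat \<Rightarrow> nat \<Rightarrow> real \<Rightarrow> 'a \<Rightarrow> real" where
  "F_sl X n r u \<omega> =
     (\<Sum>i=0..n - r. of_bool (block_max X i (i + r) \<omega> \<le> u)) / real (n - r + 1)"

definition tau_hat :: "(nat \<Rightarrow> 'a \<Rightarrow> real) \<Rightarrow> nat \<Rightarrow> nat \<Rightarrow> real \<Rightarrow> 'a \<Rightarrow> real" where
  "tau_hat X n r u \<omega> =
     (\<Sum>i=1..r * (n div r). of_bool (X i \<omega> > u)) / real (n div r)"

text \<open>
  The parameter \<open>c\<close> is the value assigned where \<open>- log F / \<tau>\<close> is undefined,
  that is, where \<open>log 0\<close> or a division by zero would occur.
\<close>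

definition theta_dj :: "real \<Rightarrow> (nat \<Rightarrow> 'a \<Rightarrow> real) \<Rightarrow> nat \<Rightarrow> nat \<Rightarrow> real \<Rightarrow> 'a \<Rightarrow> real" where
  "theta_dj c X n r u \<omega> =
     (if F_dj X n r u \<omega> = 0 \<or> tau_hat X n r u \<omega> = 0 then c
      else - (ln (F_dj X n r u \<omega>) / tau_hat X n r u \<omega>))"

definition theta_sl :: "real \<Rightarrow> (nat \<Rightarrow> 'a \<Rightarrow> real) \<Rightarrow> nat \<Rightarrow> nat \<Rightarrow> real \<Rightarrow> 'a \<Rightarrow> real" where
  "theta_sl c X n r u \<omega> =
     (if F_sl X n r u \<omega> = 0 \<or> tau_hat X n r u \<omega> = 0 then c
      else - (ln (F_sl X n r u \<omega>) / tau_hat X n r u \<omega>))"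

definition var :: "'a measure \<Rightarrow> ('a \<Rightarrow> real) \<Rightarrow> real" where
  "var M \<xi> = (\<integral>\<omega>. (\<xi> \<omega> - (\<integral>x. \<xi> x \<partial>M))\<^sup>2 \<partial>M)"

definition cov :: "'a measure \<Rightarrow> ('a \<Rightarrow> real) \<Rightarrow> ('a \<Rightarrow> real) \<Rightarrow> real" where
  "cov M \<xi> \<eta> = (\<integral>\<omega>. (\<xi> \<omega> - (\<integral>x. \<xi> x \<partial>M)) * (\<eta> \<omega> - (\<integral>x. \<eta> x \<partial>M)) \<partial>M)"

definition corr :: "'a measure \<Rightarrow> ('a \<Rightarrow> real) \<Rightarrow> ('a \<Rightarrow> real) \<Rightarrow> real" where
  "corr M \<xi> \<eta> = cov M \<xi> \<eta> / sqrt (var M \<xi> * var M \<eta>)"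

definition exceed_field ::
    "'a measure \<Rightarrow> (nat \<Rightarrow> 'a \<Rightarrow> real) \<Rightarrow> real \<Rightarrow> nat \<Rightarrow> nat \<Rightarrow> 'a measure" where
  "exceed_field M X u a b = sigma (space M) {{\<omega> \<in> space M. X i \<omega> \<le> u} | i. i \<in> {a..b}}"

text \<open>
  Of its second argument \<open>G\<close> only the \<open>\<sigma>\<close>-field is used; integrals are taken under \<open>M\<close>.
\<close>

definition L2 :: "'a measure \<Rightarrow> 'a measure \<Rightarrow> ('a \<Rightarrow> real) set" where
  "L2 M G = {\<xi> \<in> borel_measurable G. integrable M (\<lambda>\<omega>. (\<xi> \<omega>)\<^sup>2)}"

text \<open>
  All values \<open>\<bar>corr\<bar>\<close> lie in \<open>[0, 1]\<close>, so inserting \<open>0\<close> only implements the convention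
  that a supremum or maximum over the empty set is \<open>0\<close>.
\<close>

definition max_corr :: "'a measure \<Rightarrow> 'a measure \<Rightarrow> 'a measure \<Rightarrow> real" where
  "max_corr M G H = Sup (insert 0
     {\<bar>corr M \<xi> \<eta>\<bar> | \<xi> \<eta>. \<xi> \<in> L2 M G \<and> \<eta> \<in> L2 M H \<and> var M \<xi> > 0 \<and> var M \<eta> > 0})"

definition rho ::
    "'a measure \<Rightarrow> (nat \<Rightarrow> 'a \<Rightarrow> real) \<Rightarrow> nat \<Rightarrow> nat \<Rightarrow> real \<Rightarrow> real" where
  "rho M X n l u = Max (insert 0
     ((\<lambda>t. max_corr M (exceed_field M X u 1 t) (exceed_field M X u (t + l) n)) ` {1..n - l}))"

definition tendsto_in_prob :: "'a measure \<Rightarrow> (nat \<Rightarrow> 'a \<Rightarrow> real) \<Rightarrow> real \<Rightarrow> bool" where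
  "tendsto_in_prob M Y c \<longleftrightarrow>
     (\<forall>\<epsilon>>0. (\<lambda>n. \<P>(\<omega> in M. \<bar>Y n \<omega> - c\<bar> > \<epsilon>)) \<longlonglongrightarrow> 0)"

text \<open>
  Expectation given an event; \<open>uniform_measure M {\<omega> \<in> space M. P \<omega>}\<close> is \<open>M\<close> conditioned on \<open>P\<close>.
\<close>

definition cond_expectation :: "'a measure \<Rightarrow> ('a \<Rightarrow> real) \<Rightarrow> ('a \<Rightarrow> bool) \<Rightarrow> real" where
  "cond_expectation M Y P = (\<integral>\<omega>. Y \<omega> \<partial>uniform_measure M {\<omega> \<in> space M. P \<omega>})"

end

theory Submission
  imports Defs
begin

text \<open>
  Both estimators have the form \<open>- (ln A / B)\<close>, where \<open>B = tau_hat\<close> and \<open>A\<close> is the proportion of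
  blocks without an exceedance. By continuity of \<open>(x, y) \<mapsto> - (ln x / y)\<close>
  (\<open>log_ratio_tendsto_in_prob\<close>) it suffices that \<open>A\<close> tends to \<open>exp (- \<theta> * \<tau>)\<close> and \<open>B\<close> to
  \<open>\<tau>\<close> in probability, and by Chebyshev's inequality (\<open>tendsto_in_prob_of_moments\<close>) this follows
  if the means have these limits and the variances vanish.

  Means. By stationarity \<open>B\<close> has mean \<open>r\<close> times the marginal tail at \<open>u r\<close>, which tends to \<open>\<tau>\<close>
  by assumption, and \<open>A\<close> has mean \<open>P (M\<^sub>r \<le> u r)\<close>. The extremal index gives the limit of that
  probability for some sequence of levels in place of \<open>u\<close>. Two sequences of levels with the
  same limit of \<open>r\<close> times the tail are equivalent here, since the two events differ only if one
  of the \<open>r\<close> variables falls between the levels (\<open>prob_block_max_tendsto\<close>).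

  Variances. Functionals of two stretches of the sequence which are \<open>l\<close> apart have covariance at
  most \<open>rho\<close> times their standard deviations (\<open>cov_le_rho\<close>). For \<open>N\<close> functionals with variance at
  most \<open>V\<close> that are separated in this way whenever their indices differ by at least \<open>d\<close>, the sum
  has variance at most \<open>N V (2 d + N rho)\<close> (\<open>var_sum_le_of_weak_dependence\<close>).

  \<^item> For \<open>A\<close> the functionals are block indicators, so \<open>V = 1\<close> and the average has variance at most
    \<open>2 d / N + rho\<close>. For disjoint blocks \<open>N\<close> is about \<open>n / r\<close> and \<open>d = 2\<close>, for sliding
    blocks \<open>N = n - r + 1\<close> and \<open>d = 2 r\<close>; both give \<open>O (r / n) + rho\<close>, which vanishes.

  \<^item> For \<open>B\<close> the exceedances are grouped into blocks of the intermediate length \<open>s\<close>. A block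
    count has second moment \<open>E (N\<^sub>s\<^sup>2 | M\<^sub>s > u) P (M\<^sub>s > u) \<le> K s p\<close>, where \<open>p\<close> is the marginal
    tail and \<open>K\<close> comes from the convergence of the conditional second moments. There are about
    \<open>n / s\<close> blocks and \<open>rho = o (s / n)\<close>, so the total count has variance \<open>O (n p)\<close>, and
    dividing by the squared number \<open>(n / r)\<^sup>2\<close> of blocks of length \<open>r\<close> leaves
    \<open>O ((r p) (r / n))\<close>, which vanishes (\<open>tau_hat_moments\<close>).
\<close>

section \<open>Variance of weakly dependent sums\<close>

context prob_space
begin

lemma expectation_mult_squared_le:
  fixes f g :: "'a \<Rightarrow> real"
  assumes f [measurable]: "f \<in> borel_measurable M" and g [measurable]: "g \<in> borel_measurable M"
    and f2: "integrable M (\<lambda>\<omega>. (f \<omega>)\<^sup>2)" and g2: "integrable M (\<lambda>\<omega>. (g \<omega>)\<^sup>2)"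
  shows "integrable M (\<lambda>\<omega>. f \<omega> * g \<omega>)"
    and "(expectation (\<lambda>\<omega>. f \<omega> * g \<omega>))\<^sup>2 \<le> expectation (\<lambda>\<omega>. (f \<omega>)\<^sup>2) * expectation (\<lambda>\<omega>. (g \<omega>)\<^sup>2)"
proof -
  have bound: "\<bar>f \<omega> * g \<omega>\<bar> \<le> (f \<omega>)\<^sup>2 + (g \<omega>)\<^sup>2" for \<omega>
  proof -
    have "0 \<le> (\<bar>f \<omega>\<bar> - \<bar>g \<omega>\<bar>)\<^sup>2" by simp
    then have "2 * (\<bar>f \<omega>\<bar> * \<bar>g \<omega>\<bar>) \<le> (f \<omega>)\<^sup>2 + (g \<omega>)\<^sup>2"
      by (simp add: power2_diff)
    moreover have "0 \<le> \<bar>f \<omega>\<bar> * \<bar>g \<omega>\<bar>" by simp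
    ultimately show ?thesis unfolding abs_mult by linarith
  qed
  show fg: "integrable M (\<lambda>\<omega>. f \<omega> * g \<omega>)"
    by (rule Bochner_Integration.integrable_bound[OF Bochner_Integration.integrable_add[OF f2 g2]])
      (use bound in \<open>auto intro!: AE_I2 order_trans[OF bound]\<close>)
  let ?A = "expectation (\<lambda>\<omega>. (f \<omega>)\<^sup>2)" and ?B = "expectation (\<lambda>\<omega>. f \<omega> * g \<omega>)"
    and ?C = "expectation (\<lambda>\<omega>. (g \<omega>)\<^sup>2)"
  have quad: "0 \<le> t\<^sup>2 * ?A + 2 * t * ?B + ?C" for t
  proof -
    have "0 \<le> expectation (\<lambda>\<omega>. (t * f \<omega> + g \<omega>)\<^sup>2)" by simp
    also have "(\<lambda>\<omega>. (t * f \<omega> + g \<omega>)\<^sup>2) =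
        (\<lambda>\<omega>. t\<^sup>2 * (f \<omega>)\<^sup>2 + 2 * t * (f \<omega> * g \<omega>) + (g \<omega>)\<^sup>2)"
      by (auto simp: power2_eq_square algebra_simps)
    also have "expectation \<dots> = t\<^sup>2 * ?A + 2 * t * ?B + ?C"
      using f2 g2 fg by simp
    finally show ?thesis .
  qed
  show "?B\<^sup>2 \<le> ?A * ?C"
  proof (cases "?A = 0")
    case True
    then have "AE \<omega> in M. (f \<omega>)\<^sup>2 = 0"
      using f2 by (subst (asm) integral_nonneg_eq_0_iff_AE) auto
    then have "?B = 0"
      by (intro integral_eq_zero_AE) auto
    then show ?thesis using True by simp
  next
    case False
    then have "?A > 0" by (simp add: order_less_le)
    \<comment> \<open>The quadratic is minimal at \<open>t = - ?B / ?A\<close>.\<close>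
    moreover have "0 \<le> (?B / ?A)\<^sup>2 * ?A - 2 * (?B / ?A) * ?B + ?C"
      using quad[of "- ?B / ?A"] by simp
    ultimately show ?thesis
      by (simp add: power2_eq_square field_simps)
  qed
qed

lemma centred_square_integrable:
  fixes f :: "'a \<Rightarrow> real"
  assumes [measurable]: "f \<in> borel_measurable M" and "integrable M (\<lambda>\<omega>. (f \<omega>)\<^sup>2)"
  shows "integrable M (\<lambda>\<omega>. (f \<omega> - a)\<^sup>2)"
  using assms square_integrable_imp_integrable[OF assms]
  by (simp add: power2_diff)

lemma integrable_bounded_square:
  fixes f :: "'a \<Rightarrow> real"
  assumes [measurable]: "f \<in> borel_measurable M" and "\<And>\<omega>. 0 \<le> f \<omega>" "\<And>\<omega>. f \<omega> \<le> B"
  shows "integrable M (\<lambda>\<omega>. (f \<omega>)\<^sup>2)"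
  by (rule integrable_const_bound[where B = "B\<^sup>2"])
    (use assms in \<open>auto intro!: AE_I2 power_mono\<close>)

lemma cov_squared_le:
  fixes f g :: "'a \<Rightarrow> real"
  assumes [measurable]: "f \<in> borel_measurable M" "g \<in> borel_measurable M"
    and "integrable M (\<lambda>\<omega>. (f \<omega>)\<^sup>2)" "integrable M (\<lambda>\<omega>. (g \<omega>)\<^sup>2)"
  shows "(cov M f g)\<^sup>2 \<le> var M f * var M g"
  unfolding cov_def var_def
  by (intro expectation_mult_squared_le centred_square_integrable) (use assms in auto)

lemma abs_corr_le_1:
  assumes [measurable]: "f \<in> borel_measurable M" "g \<in> borel_measurable M"
    and "integrable M (\<lambda>\<omega>. (f \<omega>)\<^sup>2)" "integrable M (\<lambda>\<omega>. (g \<omega>)\<^sup>2)"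
    and "0 < var M f" "0 < var M g"
  shows "\<bar>corr M f g\<bar> \<le> 1"
proof -
  have "\<bar>cov M f g\<bar> \<le> sqrt (var M f * var M g)"
    using real_sqrt_le_mono[OF cov_squared_le[OF assms(1-4)]] by simp
  then show ?thesis
    unfolding corr_def using assms(5,6) by (simp add: abs_mult divide_le_eq_1 real_sqrt_mult)
qed

lemma var_nonneg: "0 \<le> var M f"
  unfolding var_def by simp

lemma var_le_second_moment:
  assumes "f \<in> borel_measurable M" "integrable M (\<lambda>\<omega>. (f \<omega>)\<^sup>2)"
  shows "var M f \<le> expectation (\<lambda>\<omega>. (f \<omega>)\<^sup>2)"
  unfolding var_def using variance_eq[OF square_integrable_imp_integrable[OF assms] assms(2)] by simp

lemma var_divide: "var M (\<lambda>\<omega>. f \<omega> / a) = var M f / a\<^sup>2"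
proof -
  have "var M (\<lambda>\<omega>. f \<omega> / a) = expectation (\<lambda>\<omega>. (f \<omega> - expectation f)\<^sup>2 / a\<^sup>2)"
    unfolding var_def by (simp add: diff_divide_distrib[symmetric] power_divide)
  then show ?thesis unfolding var_def by simp
qed

lemma var_sum:
  fixes Y :: "'i \<Rightarrow> 'a \<Rightarrow> real"
  assumes "finite I"
    and Y: "\<And>i. i \<in> I \<Longrightarrow> Y i \<in> borel_measurable M"
    and Y2: "\<And>i. i \<in> I \<Longrightarrow> integrable M (\<lambda>\<omega>. (Y i \<omega>)\<^sup>2)"
  shows "var M (\<lambda>\<omega>. \<Sum>i\<in>I. Y i \<omega>) = (\<Sum>i\<in>I. \<Sum>j\<in>I. cov M (Y i) (Y j))"
proof -
  have int: "integrable M (Y i)" if "i \<in> I" for i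
    using square_integrable_imp_integrable[OF Y[OF that] Y2[OF that]] .
  have int2: "integrable M (\<lambda>\<omega>. (Y i \<omega> - expectation (Y i)) * (Y j \<omega> - expectation (Y j)))"
    if "i \<in> I" "j \<in> I" for i j
    using that by (intro expectation_mult_squared_le(1) centred_square_integrable Y2)
      (auto intro!: borel_measurable_diff Y)
  have "var M (\<lambda>\<omega>. \<Sum>i\<in>I. Y i \<omega>) = expectation (\<lambda>\<omega>. (\<Sum>i\<in>I. Y i \<omega> - expectation (Y i))\<^sup>2)"
    unfolding var_def using int by (simp add: Bochner_Integration.integral_sum sum_subtractf)
  also have "\<dots> = expectation (\<lambda>\<omega>. \<Sum>i\<in>I. \<Sum>j\<in>I.
      (Y i \<omega> - expectation (Y i)) * (Y j \<omega> - expectation (Y j)))"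
    by (simp add: power2_eq_square sum_product)
  also have "\<dots> = (\<Sum>i\<in>I. \<Sum>j\<in>I. cov M (Y i) (Y j))"
    unfolding cov_def using int2
    by (simp add: Bochner_Integration.integral_sum Bochner_Integration.integrable_sum)
  finally show ?thesis .
qed

text \<open>
  The variance of a sum is the sum of all covariances. In each row of the covariance matrix at
  most \<open>2 d\<close> entries lie near the diagonal, where Cauchy-Schwarz bounds them by \<open>V\<close>; each
  of the at most \<open>m\<close> remaining ones is at most \<open>q V\<close>.
\<close>

lemma var_sum_le_of_weak_dependence:
  fixes Y :: "nat \<Rightarrow> 'a \<Rightarrow> real"
  assumes Y: "\<And>i. i < m \<Longrightarrow> Y i \<in> borel_measurable M"
    and Y2: "\<And>i. i < m \<Longrightarrow> integrable M (\<lambda>\<omega>. (Y i \<omega>)\<^sup>2)"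
    and V: "\<And>i. i < m \<Longrightarrow> var M (Y i) \<le> V"
    and far: "\<And>i j. i + d \<le> j \<Longrightarrow> j < m \<Longrightarrow>
                \<bar>cov M (Y i) (Y j)\<bar> \<le> q * sqrt (var M (Y i) * var M (Y j))"
    and "0 \<le> q" "0 \<le> V"
  shows "var M (\<lambda>\<omega>. \<Sum>i<m. Y i \<omega>) \<le> real m * V * (2 * real d + real m * q)"
proof -
  have sqrtV: "sqrt (var M (Y i) * var M (Y j)) \<le> V" if "i < m" "j < m" for i j
  proof -
    have "var M (Y i) * var M (Y j) \<le> V * V"
      using that V var_nonneg \<open>0 \<le> V\<close> by (intro mult_mono) auto
    then show ?thesis using \<open>0 \<le> V\<close> by (intro real_le_lsqrt) (simp_all add: power2_eq_square)
  qed
  have sym: "cov M (Y i) (Y j) = cov M (Y j) (Y i)" for i j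
    unfolding cov_def by (simp add: mult.commute)
  have near: "\<bar>cov M (Y i) (Y j)\<bar> \<le> V" if "i < m" "j < m" for i j
    using real_sqrt_le_mono[OF cov_squared_le[OF Y[OF that(1)] Y[OF that(2)] Y2[OF that(1)] Y2[OF that(2)]]]
      sqrtV[OF that] by simp
  have far': "\<bar>cov M (Y i) (Y j)\<bar> \<le> q * V" if "i < m" "j < m" "i + d \<le> j \<or> j + d \<le> i" for i j
    using that far[of i j] far[of j i] sym[of i j] mult_left_mono[OF sqrtV[of i j] \<open>0 \<le> q\<close>]
      mult_left_mono[OF sqrtV[of j i] \<open>0 \<le> q\<close>] by linarith
  have row: "(\<Sum>j<m. cov M (Y i) (Y j)) \<le> V * (2 * real d) + real m * (q * V)" if i: "i < m" for i
  proof -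
    have "(\<Sum>j<m. cov M (Y i) (Y j)) \<le> (\<Sum>j<m. V * indicator {i + 1 - d..<i + d} j + q * V)"
    proof (rule sum_mono)
      fix j assume "j \<in> {..<m}"
      then have j: "j < m" by simp
      show "cov M (Y i) (Y j) \<le> V * indicator {i + 1 - d..<i + d} j + q * V"
      proof (cases "j \<in> {i + 1 - d..<i + d}")
        case True
        then show ?thesis using near[OF i j] mult_nonneg_nonneg[OF \<open>0 \<le> q\<close> \<open>0 \<le> V\<close>] by simp
      next
        case False
        then have "i + d \<le> j \<or> j + d \<le> i" by auto
        then show ?thesis using far'[OF i j] False by simp
      qed
    qed
    also have "\<dots> = V * real (card ({..<m} \<inter> {i + 1 - d..<i + d})) + real m * (q * V)"
      using sum.inter_restrict[of "{..<m}" "\<lambda>_. 1 :: real" "{i + 1 - d..<i + d}"]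
      by (simp add: sum.distrib sum_distrib_left[symmetric] indicator_def of_bool_def)
    also have "card ({..<m} \<inter> {i + 1 - d..<i + d}) \<le> card {i + 1 - d..<i + d}"
      by (intro card_mono) auto
    then have "V * real (card ({..<m} \<inter> {i + 1 - d..<i + d})) \<le> V * (2 * real d)"
      using \<open>0 \<le> V\<close> by (intro mult_left_mono) auto
    finally show ?thesis by simp
  qed
  have "var M (\<lambda>\<omega>. \<Sum>i<m. Y i \<omega>) = (\<Sum>i<m. \<Sum>j<m. cov M (Y i) (Y j))"
    using Y Y2 by (intro var_sum) auto
  also have "\<dots> \<le> (\<Sum>i<m. V * (2 * real d) + real m * (q * V))"
    using row by (intro sum_mono) auto
  also have "\<dots> = real m * V * (2 * real d + real m * q)"
    by (simp add: algebra_simps)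
  finally show ?thesis .
qed

end

section \<open>Convergence in probability\<close>

lemma tendsto_in_prob_of_moments:
  assumes "prob_space M"
    and meas: "eventually (\<lambda>n. Y n \<in> borel_measurable M) sequentially"
    and sq: "eventually (\<lambda>n. integrable M (\<lambda>\<omega>. (Y n \<omega>)\<^sup>2)) sequentially"
    and mean: "(\<lambda>n. \<integral>\<omega>. Y n \<omega> \<partial>M) \<longlonglongrightarrow> a"
    and var: "(\<lambda>n. var M (Y n)) \<longlonglongrightarrow> 0"
  shows "tendsto_in_prob M Y a"
  unfolding tendsto_in_prob_def
proof (intro allI impI)
  interpret prob_space M by fact
  fix \<epsilon> :: real assume "\<epsilon> > 0"
  have "eventually (\<lambda>n. \<bar>expectation (Y n) - a\<bar> < \<epsilon> / 2) sequentially"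
    using tendstoD[OF mean, of "\<epsilon> / 2"] \<open>\<epsilon> > 0\<close> by (simp add: dist_real_def)
  with meas sq have ev: "eventually (\<lambda>n. prob {\<omega> \<in> space M. \<bar>Y n \<omega> - a\<bar> > \<epsilon>}
      \<le> var M (Y n) / (\<epsilon> / 2)\<^sup>2) sequentially"
  proof eventually_elim
    case (elim n)
    note [measurable] = elim(1)
    have "prob {\<omega> \<in> space M. \<bar>Y n \<omega> - a\<bar> > \<epsilon>}
        \<le> prob {\<omega> \<in> space M. \<epsilon> / 2 \<le> \<bar>Y n \<omega> - expectation (Y n)\<bar>}"
    proof (rule finite_measure_mono)
      have "\<epsilon> / 2 \<le> \<bar>y - expectation (Y n)\<bar>" if "\<epsilon> < \<bar>y - a\<bar>" for y
        using elim(3) that by linarith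
      then show "{\<omega> \<in> space M. \<bar>Y n \<omega> - a\<bar> > \<epsilon>} \<subseteq> {\<omega> \<in> space M. \<epsilon> / 2 \<le> \<bar>Y n \<omega> - expectation (Y n)\<bar>}"
        by blast
    qed measurable
    also have "\<dots> \<le> var M (Y n) / (\<epsilon> / 2)\<^sup>2"
      unfolding var_def using Chebyshev_inequality[OF elim(1,2), of "\<epsilon> / 2"] \<open>\<epsilon> > 0\<close> by simp
    finally show ?case .
  qed
  have "(\<lambda>n. var M (Y n) / (\<epsilon> / 2)\<^sup>2) \<longlonglongrightarrow> 0"
    using tendsto_divide[OF var tendsto_const[of "(\<epsilon> / 2)\<^sup>2"]] \<open>\<epsilon> > 0\<close> by simp
  note lim = this
  show "(\<lambda>n. \<P>(\<omega> in M. \<bar>Y n \<omega> - a\<bar> > \<epsilon>)) \<longlonglongrightarrow> 0"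
    by (rule tendsto_sandwich[OF _ ev tendsto_const]) (use lim in simp_all)
qed

text \<open>
  This is the continuous mapping theorem for \<open>(x, y) \<mapsto> - (ln x / y)\<close> at \<open>(a, b)\<close>. Near that
  point neither coordinate vanishes, so on the event that \<open>A\<close> and \<open>B\<close> are close to their limits
  \<open>Z\<close> is given by the formula.
\<close>

lemma log_ratio_tendsto_in_prob:
  fixes A B Z :: "nat \<Rightarrow> 'a \<Rightarrow> real"
  assumes "prob_space M"
    and A: "tendsto_in_prob M A a" and B: "tendsto_in_prob M B b" and "a > 0" "b > 0"
    and measA: "eventually (\<lambda>n. A n \<in> borel_measurable M) sequentially"
    and measB: "eventually (\<lambda>n. B n \<in> borel_measurable M) sequentially"
    and Z: "\<And>n \<omega>. Z n \<omega> = (if A n \<omega> = 0 \<or> B n \<omega> = 0 then c else - (ln (A n \<omega>) / B n \<omega>))"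
  shows "tendsto_in_prob M Z (- (ln a / b))"
  unfolding tendsto_in_prob_def
proof (intro allI impI)
  interpret prob_space M by fact
  fix \<epsilon> :: real assume "\<epsilon> > 0"
  have "((\<lambda>p. - (ln (fst p) / snd p)) \<longlongrightarrow> - (ln a / b)) (nhds a \<times>\<^sub>F nhds b)"
    using \<open>a > 0\<close> \<open>b > 0\<close> by (intro tendsto_intros filterlim_fst filterlim_snd) auto
  then have "((\<lambda>p. - (ln (fst p) / snd p)) \<longlongrightarrow> - (ln a / b)) (nhds (a, b))"
    by (simp add: nhds_prod)
  then have "eventually (\<lambda>p. dist (- (ln (fst p) / snd p)) (- (ln a / b)) < \<epsilon>) (nhds (a, b))"
    using \<open>\<epsilon> > 0\<close> by (rule tendstoD)
  moreover have "eventually (\<lambda>p. 0 < fst p \<and> 0 < snd p) (nhds (a, b))"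
  proof -
    have "open ({0<..} \<times> {0<..} :: (real \<times> real) set)" by (intro open_Times) auto
    from eventually_nhds_in_open[OF this, of "(a, b)"] show ?thesis
      using \<open>a > 0\<close> \<open>b > 0\<close> by (auto elim!: eventually_mono)
  qed
  ultimately have "eventually (\<lambda>p. dist (- (ln (fst p) / snd p)) (- (ln a / b)) < \<epsilon> \<and> 0 < fst p \<and> 0 < snd p)
      (nhds (a, b))"
    by (rule eventually_conj)
  then obtain \<delta> where "\<delta> > 0" and \<delta>: "\<And>p. dist p (a, b) < \<delta> \<Longrightarrow>
      \<bar>- (ln (fst p) / snd p) - (- (ln a / b))\<bar> < \<epsilon> \<and> 0 < fst p \<and> 0 < snd p"
    unfolding eventually_nhds_metric dist_real_def by blast
  have close: "\<bar>Z n \<omega> - (- (ln a / b))\<bar> < \<epsilon>"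
    if "\<bar>A n \<omega> - a\<bar> \<le> \<delta> / 3" "\<bar>B n \<omega> - b\<bar> \<le> \<delta> / 3" for n \<omega>
  proof -
    have "dist (A n \<omega>, B n \<omega>) (a, b) \<le> \<bar>A n \<omega> - a\<bar> + \<bar>B n \<omega> - b\<bar>"
      unfolding dist_Pair_Pair dist_real_def using sqrt_sum_squares_le_sum_abs[of "A n \<omega> - a" "B n \<omega> - b"] by simp
    then have "dist (A n \<omega>, B n \<omega>) (a, b) < \<delta>" using that \<open>\<delta> > 0\<close> by linarith
    from \<delta>[OF this] show ?thesis unfolding Z by auto
  qed
  from measA measB have ev: "eventually (\<lambda>n. prob {\<omega> \<in> space M. \<bar>Z n \<omega> - (- (ln a / b))\<bar> > \<epsilon>}
      \<le> prob {\<omega> \<in> space M. \<bar>A n \<omega> - a\<bar> > \<delta> / 3} + prob {\<omega> \<in> space M. \<bar>B n \<omega> - b\<bar> > \<delta> / 3}) sequentially"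
  proof eventually_elim
    case (elim n)
    note [measurable] = elim
    have "prob {\<omega> \<in> space M. \<bar>Z n \<omega> - (- (ln a / b))\<bar> > \<epsilon>}
      \<le> prob ({\<omega> \<in> space M. \<bar>A n \<omega> - a\<bar> > \<delta> / 3} \<union> {\<omega> \<in> space M. \<bar>B n \<omega> - b\<bar> > \<delta> / 3})"
    proof (rule finite_measure_mono)
      show "{\<omega> \<in> space M. \<epsilon> < \<bar>Z n \<omega> - - (ln a / b)\<bar>}
        \<subseteq> {\<omega> \<in> space M. \<bar>A n \<omega> - a\<bar> > \<delta> / 3} \<union> {\<omega> \<in> space M. \<bar>B n \<omega> - b\<bar> > \<delta> / 3}"
      proof
        fix \<omega> assume *: "\<omega> \<in> {\<omega> \<in> space M. \<epsilon> < \<bar>Z n \<omega> - - (ln a / b)\<bar>}"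
        then have "\<not> (\<bar>A n \<omega> - a\<bar> \<le> \<delta> / 3 \<and> \<bar>B n \<omega> - b\<bar> \<le> \<delta> / 3)"
          using close[of n \<omega>] by auto
        then show "\<omega> \<in> {\<omega> \<in> space M. \<bar>A n \<omega> - a\<bar> > \<delta> / 3} \<union> {\<omega> \<in> space M. \<bar>B n \<omega> - b\<bar> > \<delta> / 3}"
          using * by auto
      qed
    qed measurable
    also have "\<dots> \<le> prob {\<omega> \<in> space M. \<bar>A n \<omega> - a\<bar> > \<delta> / 3} + prob {\<omega> \<in> space M. \<bar>B n \<omega> - b\<bar> > \<delta> / 3}"
      by (intro measure_Un_le) auto
    finally show ?case .
  qed
  have "(\<lambda>n. prob {\<omega> \<in> space M. \<bar>A n \<omega> - a\<bar> > \<delta> / 3} + prob {\<omega> \<in> space M. \<bar>B n \<omega> - b\<bar> > \<delta> / 3}) \<longlonglongrightarrow> 0 + 0"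
    using A[unfolded tendsto_in_prob_def, rule_format, of "\<delta> / 3"] B[unfolded tendsto_in_prob_def, rule_format, of "\<delta> / 3"]
      \<open>\<delta> > 0\<close> by (intro tendsto_add) (auto simp del: less_divide_eq_numeral1 divide_less_eq_numeral1)
  note lim = this
  show "(\<lambda>n. \<P>(\<omega> in M. \<bar>Z n \<omega> - (- (ln a / b))\<bar> > \<epsilon>)) \<longlonglongrightarrow> 0"
    by (rule tendsto_sandwich[OF _ ev tendsto_const]) (use lim in simp_all)
qed

section \<open>Block maxima and exceedance counts of a stationary sequence\<close>

lemma le_twice_mult_div:
  fixes m n :: nat
  assumes "1 \<le> m" "m \<le> n"
  shows "1 \<le> n div m" "real n \<le> 2 * real m * real (n div m)"
proof -
  show pos: "1 \<le> n div m" using assms by (simp add: div_greater_zero_iff Suc_le_eq)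
  have "n < m + n div m * m" using assms by (intro dividend_less_div_times) simp
  moreover have "m \<le> n div m * m" using mult_right_mono[OF pos, of m] by simp
  ultimately have "n \<le> 2 * (n div m * m)" by linarith
  then have "real n \<le> real (2 * (n div m * m))" by (simp only: of_nat_le_iff)
  then show "real n \<le> 2 * real m * real (n div m)" by (simp add: algebra_simps)
qed

locale stationary_sequence = prob_space +
  fixes X :: "nat \<Rightarrow> 'a \<Rightarrow> real"
  assumes stationary: "strictly_stationary M X"
begin

lemma measurable_X: "1 \<le> i \<Longrightarrow> X i \<in> borel_measurable M"
  using stationary unfolding strictly_stationary_def by blast

lemma expectation_shift:
  fixes g :: "(nat \<Rightarrow> real) \<Rightarrow> real"
  assumes "finite J" "J \<subseteq> {1..}" and g: "g \<in> borel_measurable (Pi\<^sub>M J (\<lambda>_. borel))"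
  shows "expectation (\<lambda>\<omega>. g (\<lambda>i\<in>J. X (i + h) \<omega>)) = expectation (\<lambda>\<omega>. g (\<lambda>i\<in>J. X i \<omega>))"
proof -
  have meas: "(\<lambda>\<omega>. \<lambda>i\<in>J. X (i + k) \<omega>) \<in> measurable M (Pi\<^sub>M J (\<lambda>_. borel))" for k
    using assms(2) by (intro measurable_restrict measurable_X) auto
  have "distr M (Pi\<^sub>M J (\<lambda>_. borel)) (\<lambda>\<omega>. \<lambda>i\<in>J. X (i + h) \<omega>) =
      distr M (Pi\<^sub>M J (\<lambda>_. borel)) (\<lambda>\<omega>. \<lambda>i\<in>J. X i \<omega>)"
    using stationary assms(1,2) unfolding strictly_stationary_def by blast
  then show ?thesis
    using integral_distr[OF meas[of h] g] integral_distr[OF meas[of 0] g] by simp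
qed

text \<open>
  Exceedances are counted from index 0, so that block number \<open>i\<close> of length \<open>m\<close> is
  \<open>{i * m..<i * m + m}\<close>.
\<close>

definition hit :: "real \<Rightarrow> nat \<Rightarrow> 'a \<Rightarrow> real" where
  "hit v i \<omega> = of_bool (v < X (Suc i) \<omega>)"

lemma measurable_hit [measurable]: "hit v i \<in> borel_measurable M"
proof -
  have [measurable]: "X (Suc i) \<in> borel_measurable M" by (simp add: measurable_X)
  show ?thesis unfolding hit_def by measurable
qed

lemma hit_bounds: "0 \<le> hit v i \<omega>" "hit v i \<omega> \<le> 1"
  unfolding hit_def by auto

lemma exceedances_eq_sum_hit: "real (exceedances X m v \<omega>) = (\<Sum>i<m. hit v i \<omega>)"
  unfolding exceedances_def hit_def One_nat_def sum.atLeast1_atMost_eq by simp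

lemma expectation_hit: "expectation (hit v i) = marginal_tail M X v"
proof -
  have [measurable]: "X (Suc 0) \<in> borel_measurable M" by (simp add: measurable_X)
  have "expectation (hit v i) = expectation (\<lambda>\<omega>. (\<lambda>x. of_bool (v < x 1)) (\<lambda>k\<in>{1}. X (k + i) \<omega>))"
    unfolding hit_def by simp
  also have "\<dots> = expectation (\<lambda>\<omega>. (\<lambda>x. of_bool (v < x 1)) (\<lambda>k\<in>{1}. X k \<omega>))"
    by (rule expectation_shift) auto
  also have "\<dots> = expectation (indicator {\<omega> \<in> space M. v < X 1 \<omega>})"
    by (intro Bochner_Integration.integral_cong) (auto simp: indicator_def)
  also have "\<dots> = prob {\<omega> \<in> space M. \<not> X 1 \<omega> \<le> v}"
    by (simp add: not_le)
  also have "\<dots> = 1 - prob {\<omega> \<in> space M. X 1 \<omega> \<le> v}"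
    by (intro prob_neg) simp
  also have "{\<omega> \<in> space M. X 1 \<omega> \<le> v} = X 1 -` {..v} \<inter> space M" by auto
  finally show ?thesis
    unfolding marginal_tail_def cdf_def by (simp add: measure_distr)
qed

lemma marginal_tail_nonneg: "0 \<le> marginal_tail M X v"
  unfolding expectation_hit[of v 0, symmetric] by (simp add: hit_bounds)

lemma second_moment_block_count:
  "expectation (\<lambda>\<omega>. (\<Sum>i<m. hit v (h + i) \<omega>)\<^sup>2) = expectation (\<lambda>\<omega>. (\<Sum>i<m. hit v i \<omega>)\<^sup>2)"
proof -
  let ?g = "\<lambda>x :: nat \<Rightarrow> real. (\<Sum>i<m. of_bool (v < x (Suc i)) :: real)\<^sup>2"
  have "expectation (\<lambda>\<omega>. ?g (\<lambda>i\<in>{1..m}. X (i + h) \<omega>)) = expectation (\<lambda>\<omega>. ?g (\<lambda>i\<in>{1..m}. X i \<omega>))"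
    by (rule expectation_shift) measurable
  then show ?thesis
    unfolding hit_def by (simp add: add.commute)
qed

lemma block_max_le_iff:
  assumes "a < b"
  shows "block_max X a b \<omega> \<le> v \<longleftrightarrow> (\<forall>i\<in>{a<..b}. X i \<omega> \<le> v)"
  unfolding block_max_def using assms by (subst Max_le_iff) auto

definition calm :: "real \<Rightarrow> nat \<Rightarrow> nat \<Rightarrow> 'a \<Rightarrow> real" where
  "calm v a b \<omega> = of_bool (block_max X a b \<omega> \<le> v)"

lemma calm_bounds: "0 \<le> calm v a b \<omega>" "calm v a b \<omega> \<le> 1"
  unfolding calm_def by auto

lemma measurable_calm:
  assumes "a < b"
  shows "calm v a b \<in> borel_measurable M"
proof -
  have [measurable]: "X i \<in> borel_measurable M" if "i \<in> {a<..b}" for i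
    using that by (intro measurable_X) auto
  show ?thesis unfolding calm_def block_max_le_iff[OF assms] by measurable
qed

lemma expectation_calm:
  assumes "1 \<le> m"
  shows "expectation (calm v h (h + m)) = \<P>(\<omega> in M. block_max X 0 m \<omega> \<le> v)"
proof -
  let ?g = "\<lambda>x :: nat \<Rightarrow> real. of_bool (\<forall>i\<in>{1..m}. x i \<le> v) :: real"
  have shift: "(\<forall>i\<in>{h<..h + m}. P i) \<longleftrightarrow> (\<forall>i\<in>{1..m}. P (i + h))" for P :: "nat \<Rightarrow> bool" and h
  proof (intro iffI ballI)
    fix i assume P: "\<forall>i\<in>{1..m}. P (i + h)" and i: "i \<in> {h<..h + m}"
    have "P ((i - h) + h)" using i by (intro P[rule_format]) auto
    then show "P i" using i by simp
  qed auto
  have calm: "calm v h (h + m) = (\<lambda>\<omega>. ?g (\<lambda>i\<in>{1..m}. X (i + h) \<omega>))" for h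
    unfolding calm_def using assms by (subst block_max_le_iff) (auto simp: fun_eq_iff shift)
  have "expectation (calm v h (h + m)) = expectation (calm v 0 (0 + m))"
    unfolding calm using expectation_shift[of "{1..m}" ?g h] by simp
  also have "\<dots> = expectation (indicator {\<omega> \<in> space M. block_max X 0 m \<omega> \<le> v})"
    by (intro Bochner_Integration.integral_cong) (auto simp: calm_def indicator_def)
  finally show ?thesis by (simp add: Int_absorb2 subset_eq)
qed

text \<open>
  For \<open>v \<le> w\<close> the maximum can exceed \<open>v\<close> without exceeding \<open>w\<close> only if some \<open>X i\<close> falls in
  between, which has probability \<open>marginal_tail M X v - marginal_tail M X w\<close> for each \<open>i\<close>. Hence
  the distribution of the maximum at a level is determined, in the limit, by the expected number
  of exceedances.
\<close>

lemma prob_block_max_diff_le: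
  assumes "1 \<le> m"
  shows "\<bar>\<P>(\<omega> in M. block_max X 0 m \<omega> \<le> v) - \<P>(\<omega> in M. block_max X 0 m \<omega> \<le> w)\<bar>
    \<le> real m * \<bar>marginal_tail M X v - marginal_tail M X w\<bar>"
proof -
  have main: "\<bar>expectation (calm v 0 m) - expectation (calm w 0 m)\<bar>
      \<le> real m * \<bar>marginal_tail M X v - marginal_tail M X w\<bar>" if "v \<le> w" for v w
  proof -
    have int: "integrable M (hit v i)" "integrable M (calm v 0 m)" for v i
      using assms by (auto intro!: integrable_const_bound[where B = 1] AE_I2 measurable_calm
          simp: hit_bounds calm_bounds)
    have le: "calm v 0 m \<omega> \<le> calm w 0 m \<omega>" for \<omega>
      unfolding calm_def using that by auto
    have diff: "calm w 0 m \<omega> - calm v 0 m \<omega> \<le> (\<Sum>i<m. hit v i \<omega> - hit w i \<omega>)" for \<omega>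
    proof (cases "calm w 0 m \<omega> = 1 \<and> calm v 0 m \<omega> = 0")
      case True
      then obtain j where j: "j \<in> {0<..m}" "v < X j \<omega>" and w: "\<And>i. i \<in> {0<..m} \<Longrightarrow> X i \<omega> \<le> w"
        using assms by (auto simp: calm_def block_max_le_iff not_le split: if_splits)
      have "1 = hit v (j - 1) \<omega> - hit w (j - 1) \<omega>"
        using j w[OF j(1)] by (auto simp: hit_def)
      also have "\<dots> \<le> (\<Sum>i<m. hit v i \<omega> - hit w i \<omega>)"
        by (rule member_le_sum) (use j that in \<open>auto simp: hit_def\<close>)
      finally show ?thesis using True by simp
    next
      case False
      then have "calm w 0 m \<omega> - calm v 0 m \<omega> \<le> 0" by (auto simp: calm_def)
      also have "\<dots> \<le> (\<Sum>i<m. hit v i \<omega> - hit w i \<omega>)"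
        using that by (intro sum_nonneg) (auto simp: hit_def)
      finally show ?thesis .
    qed
    have "\<bar>expectation (calm v 0 m) - expectation (calm w 0 m)\<bar> = expectation (\<lambda>\<omega>. calm w 0 m \<omega> - calm v 0 m \<omega>)"
      using integral_mono[OF int(2) int(2) le] int by simp
    also have "\<dots> \<le> expectation (\<lambda>\<omega>. \<Sum>i<m. hit v i \<omega> - hit w i \<omega>)"
      using int diff by (intro integral_mono) auto
    also have "\<dots> = real m * (marginal_tail M X v - marginal_tail M X w)"
      using int by (simp add: expectation_hit)
    also have "\<dots> \<le> real m * \<bar>marginal_tail M X v - marginal_tail M X w\<bar>"
      by (intro mult_left_mono) auto
    finally show ?thesis .
  qed
  have "expectation (calm y 0 m) = \<P>(\<omega> in M. block_max X 0 m \<omega> \<le> y)" for y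
    using expectation_calm[OF assms, of y 0] by simp
  then show ?thesis
    using main[of v w] main[of w v] by (cases "v \<le> w") (simp_all add: abs_minus_commute)
qed

text \<open>
  The count vanishes unless the maximum exceeds \<open>v\<close>, so its second moment is the conditional one
  times the probability of an exceedance. If that probability is zero, both sides are.
\<close>

lemma second_moment_count_eq:
  assumes "1 \<le> m"
  shows "expectation (\<lambda>\<omega>. (\<Sum>i<m. hit v i \<omega>)\<^sup>2) =
    cond_expectation M (\<lambda>\<omega>. (real (exceedances X m v \<omega>))\<^sup>2) (\<lambda>\<omega>. block_max X 0 m \<omega> > v)
      * \<P>(\<omega> in M. block_max X 0 m \<omega> > v)"
proof -
  define A where "A = {\<omega> \<in> space M. block_max X 0 m \<omega> > v}"
  let ?f = "\<lambda>\<omega>. (\<Sum>i<m. hit v i \<omega>)\<^sup>2"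
  have zero: "?f \<omega> = 0" if "\<not> block_max X 0 m \<omega> > v" for \<omega>
  proof -
    have "X (Suc i) \<omega> \<le> v" if "i < m" for i
      using \<open>\<not> block_max X 0 m \<omega> > v\<close> assms that by (simp add: not_less block_max_le_iff)
    then have "hit v i \<omega> = 0" if "i < m" for i
      using that by (simp add: hit_def not_less)
    then show ?thesis by (simp add: sum.neutral)
  qed
  have A [measurable]: "A \<in> sets M"
  proof -
    have "A = {\<omega> \<in> space M. calm v 0 m \<omega> = 0}"
      by (auto simp: A_def calm_def)
    moreover have [measurable]: "calm v 0 m \<in> borel_measurable M"
      using assms by (intro measurable_calm) simp
    ultimately show ?thesis by simp
  qed
  have restrict: "expectation ?f = expectation (\<lambda>\<omega>. indicator A \<omega> * ?f \<omega>)"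
    using zero by (intro Bochner_Integration.integral_cong) (auto simp: A_def indicator_def)
  show ?thesis
  proof (cases "prob A = 0")
    case True
    then have "AE \<omega> in M. \<omega> \<notin> A"
      using A by (simp add: prob_eq_0)
    then have "expectation (\<lambda>\<omega>. indicator A \<omega> * ?f \<omega>) = 0"
      by (intro integral_eq_zero_AE) auto
    with True show ?thesis by (simp add: restrict A_def)
  next
    case False
    then have pos: "prob A > 0" by (simp add: zero_less_measure_iff)
    have "uniform_measure M A = density M (\<lambda>x. ennreal (indicator A x / prob A))"
      unfolding uniform_measure_def emeasure_eq_measure using pos
      by (intro density_cong) (auto simp: divide_ennreal[symmetric] ennreal_indicator)
    then have "cond_expectation M (\<lambda>\<omega>. (real (exceedances X m v \<omega>))\<^sup>2) (\<lambda>\<omega>. block_max X 0 m \<omega> > v)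
        = expectation (\<lambda>\<omega>. (indicator A \<omega> / prob A) *\<^sub>R ?f \<omega>)"
      unfolding cond_expectation_def A_def[symmetric] exceedances_eq_sum_hit
      by (simp only:) (rule integral_density; simp)
    also have "\<dots> = expectation ?f / prob A"
      unfolding restrict by simp
    finally show ?thesis using pos by (simp add: A_def)
  qed
qed

lemma prob_block_max_gt_le:
  assumes "1 \<le> m"
  shows "\<P>(\<omega> in M. block_max X 0 m \<omega> > v) \<le> real m * marginal_tail M X v"
proof -
  have [measurable]: "calm v 0 m \<in> borel_measurable M"
    using assms by (intro measurable_calm) simp
  have "\<P>(\<omega> in M. block_max X 0 m \<omega> > v) = expectation (\<lambda>\<omega>. 1 - calm v 0 m \<omega>)"
  proof -
    have "expectation (\<lambda>\<omega>. 1 - calm v 0 m \<omega>) = expectation (indicator {\<omega> \<in> space M. block_max X 0 m \<omega> > v})"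
      by (intro Bochner_Integration.integral_cong) (auto simp: calm_def indicator_def)
    then show ?thesis by (simp add: Int_absorb2 subset_eq)
  qed
  also have "\<dots> \<le> expectation (\<lambda>\<omega>. \<Sum>i<m. hit v i \<omega>)"
  proof (intro integral_mono)
    show "1 - calm v 0 m \<omega> \<le> (\<Sum>i<m. hit v i \<omega>)" for \<omega>
    proof (cases "block_max X 0 m \<omega> \<le> v")
      case True
      then show ?thesis by (simp add: calm_def sum_nonneg hit_bounds)
    next
      case False
      then obtain j where j: "j \<in> {0<..m}" "v < X j \<omega>"
        using assms by (auto simp: block_max_le_iff not_le)
      then have "hit v (j - 1) \<omega> \<le> (\<Sum>i<m. hit v i \<omega>)"
        by (intro member_le_sum) (auto simp: hit_bounds)
      then show ?thesis using j False by (simp add: hit_def calm_def)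
    qed
  qed (auto intro!: integrable_const_bound[where B = 1] Bochner_Integration.integrable_sum
      AE_I2 simp: calm_bounds hit_bounds)
  also have "\<dots> = real m * marginal_tail M X v"
    by (subst Bochner_Integration.integral_sum)
      (auto intro!: integrable_const_bound[where B = 1] AE_I2 simp: hit_bounds expectation_hit)
  finally show ?thesis .
qed

subsection \<open>Covariances under the maximal correlation coefficients\<close>

lemma space_exceed_field [simp]: "space (exceed_field M X v a b) = space M"
  unfolding exceed_field_def by (intro space_measure_of) auto

lemma sets_exceed_field:
  "sets (exceed_field M X v a b) =
    sigma_sets (space M) {{\<omega> \<in> space M. X i \<omega> \<le> v} | i. i \<in> {a..b}}"
  unfolding exceed_field_def by (intro sets_measure_of) auto

lemma exceed_field_mono:
  assumes "a' \<le> a" "b \<le> b'" and f: "f \<in> borel_measurable (exceed_field M X v a b)"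
  shows "f \<in> borel_measurable (exceed_field M X v a' b')"
proof -
  have "sets (exceed_field M X v a b) \<subseteq> sets (exceed_field M X v a' b')"
    unfolding sets_exceed_field using assms(1,2) by (intro sigma_sets_mono') auto
  then show ?thesis
    using f measurable_mono[of borel borel "exceed_field M X v a b" "exceed_field M X v a' b'"] by auto
qed

lemma exceed_field_le:
  assumes "1 \<le> a" and f: "f \<in> borel_measurable (exceed_field M X v a b)"
  shows "f \<in> borel_measurable M"
proof -
  have "{\<omega> \<in> space M. X i \<omega> \<le> v} \<in> sets M" if "i \<in> {a..b}" for i
  proof -
    have [measurable]: "X i \<in> borel_measurable M" using that assms(1) by (intro measurable_X) auto
    show ?thesis by measurable
  qed
  then have "sets (exceed_field M X v a b) \<subseteq> sets M"
    unfolding sets_exceed_field by (intro sets.sigma_sets_subset) auto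
  then show ?thesis
    using f measurable_mono[of borel borel "exceed_field M X v a b" M] by auto
qed

lemma pred_exceed_field:
  assumes "i \<in> {a..b}"
  shows "Measurable.pred (exceed_field M X v a b) (\<lambda>\<omega>. X i \<omega> \<le> v)"
proof -
  have "{\<omega> \<in> space M. X i \<omega> \<le> v} \<in> sets (exceed_field M X v a b)"
    unfolding sets_exceed_field using assms by (intro sigma_sets.Basic) auto
  then show ?thesis unfolding pred_def by simp
qed

lemma hit_exceed_field:
  assumes "Suc i \<in> {a..b}"
  shows "hit v i \<in> borel_measurable (exceed_field M X v a b)"
proof -
  note [measurable] = pred_exceed_field[OF assms, of v]
  have "hit v i = (\<lambda>\<omega>. of_bool (\<not> X (Suc i) \<omega> \<le> v))" by (auto simp: hit_def fun_eq_iff)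
  then show ?thesis by simp
qed

lemma calm_exceed_field:
  assumes "a < b"
  shows "calm v a b \<in> borel_measurable (exceed_field M X v (Suc a) b)"
proof -
  have [measurable]: "Measurable.pred (exceed_field M X v (Suc a) b) (\<lambda>\<omega>. X i \<omega> \<le> v)"
    if "i \<in> {a<..b}" for i
    using that by (intro pred_exceed_field) auto
  show ?thesis unfolding calm_def block_max_le_iff[OF assms] by measurable
qed

lemma rho_nonneg: "0 \<le> rho M X n k v"
  unfolding rho_def by (intro Max_ge) auto

text \<open>
  The covariance is the correlation times the two standard deviations, and the correlation is one
  of those over which \<open>rho\<close> is the maximum, with \<open>t = b\<close>. The supremum in \<open>max_corr\<close> is a genuine
  one because all correlations are at most 1.
\<close>

lemma cov_le_rho:
  assumes f: "f \<in> borel_measurable (exceed_field M X v a b)"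
    and g: "g \<in> borel_measurable (exceed_field M X v c d)"
    and f2: "integrable M (\<lambda>\<omega>. (f \<omega>)\<^sup>2)" and g2: "integrable M (\<lambda>\<omega>. (g \<omega>)\<^sup>2)"
    and idx: "1 \<le> a" "1 \<le> b" "b + k \<le> c" "b + k \<le> n" "d \<le> n"
  shows "\<bar>cov M f g\<bar> \<le> rho M X n k v * sqrt (var M f * var M g)"
proof -
  let ?G = "exceed_field M X v 1 b" and ?H = "exceed_field M X v (b + k) n"
  let ?S = "{\<bar>corr M \<xi> \<eta>\<bar> | \<xi> \<eta>. \<xi> \<in> L2 M ?G \<and> \<eta> \<in> L2 M ?H \<and> var M \<xi> > 0 \<and> var M \<eta> > 0}"
  have fG: "f \<in> borel_measurable ?G"
    using exceed_field_mono[OF idx(1) order_refl f] .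
  have gH: "g \<in> borel_measurable ?H"
    using exceed_field_mono[OF idx(3) idx(5) g] .
  have fM: "f \<in> borel_measurable M"
    using exceed_field_le[OF idx(1) f] .
  have "1 \<le> c" "1 \<le> b + k" using idx by linarith+
  then have gM: "g \<in> borel_measurable M"
    using exceed_field_le[OF _ g] by blast
  show ?thesis
  proof (cases "0 < var M f \<and> 0 < var M g")
    case True
    have "bdd_above (insert 0 ?S)"
    proof (rule bdd_aboveI[where M = 1])
      fix x assume "x \<in> insert 0 ?S"
      then consider "x = 0" | \<xi> \<eta> where "x = \<bar>corr M \<xi> \<eta>\<bar>" "\<xi> \<in> L2 M ?G" "\<eta> \<in> L2 M ?H"
        "0 < var M \<xi>" "0 < var M \<eta>"
        by blast
      then show "x \<le> 1"
      proof cases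
        case 2
        then have "\<xi> \<in> borel_measurable M" "\<eta> \<in> borel_measurable M"
          using exceed_field_le[OF order_refl, of \<xi> v b] exceed_field_le[OF \<open>1 \<le> b + k\<close>, of \<eta> v n]
          unfolding L2_def by blast+
        with 2 show ?thesis
          unfolding L2_def by (simp only: mem_Collect_eq) (intro abs_corr_le_1; blast)
      qed simp
    qed
    moreover have "\<bar>corr M f g\<bar> \<in> insert 0 ?S"
      using True fG gH f2 g2 unfolding L2_def by blast
    ultimately have "\<bar>corr M f g\<bar> \<le> max_corr M ?G ?H"
      unfolding max_corr_def by (intro cSup_upper)
    also have "\<dots> \<le> rho M X n k v"
      unfolding rho_def using idx by (intro Max_ge) auto
    finally show ?thesis
      using True by (simp add: corr_def pos_divide_le_eq abs_mult)
  next
    case False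
    \<comment> \<open>Here no correlation is defined, but Cauchy-Schwarz makes the covariance zero.\<close>
    then have zero: "var M f * var M g = 0"
      using var_nonneg[of f] var_nonneg[of g] by auto
    have "(cov M f g)\<^sup>2 \<le> 0"
      using cov_squared_le[OF fM gM f2 g2] unfolding zero .
    then have "cov M f g = 0" by simp
    then show ?thesis
      by (simp only: zero) simp
  qed
qed

lemma var_calm_le_1:
  assumes "a < b"
  shows "var M (calm v a b) \<le> 1"
proof -
  note [measurable] = measurable_calm[OF assms, of v]
  have "var M (calm v a b) \<le> expectation (\<lambda>\<omega>. (calm v a b \<omega>)\<^sup>2)"
    by (intro var_le_second_moment integrable_bounded_square[where B = 1]) (auto simp: calm_bounds)
  also have "\<dots> \<le> expectation (\<lambda>\<omega>. 1)"
    by (intro integral_mono integrable_bounded_square[where B = 1])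
      (auto simp: calm_bounds power_le_one)
  finally show ?thesis by (simp add: prob_space)
qed

text \<open>
  One statement for both block schemes: \<open>step = m\<close> gives disjoint blocks, for which a lag of
  \<open>d = 2\<close> leaves a whole block between the two, and \<open>step = 1\<close> gives sliding blocks, for which the
  lag has to be \<open>d = 2 * m\<close>. In both cases the gap has length at least \<open>m\<close>, hence at least \<open>k\<close>.
\<close>

lemma var_sum_calm_le:
  assumes "1 \<le> m" "k \<le> m" and step: "1 \<le> step" and sep: "2 * m \<le> d * step"
    and fits: "\<And>i. i < N \<Longrightarrow> i * step + m \<le> n"
  shows "var M (\<lambda>\<omega>. \<Sum>i<N. calm v (i * step) (i * step + m) \<omega>)
    \<le> real N * (2 * real d + real N * rho M X n k v)"
proof -
  have "var M (\<lambda>\<omega>. \<Sum>i<N. calm v (i * step) (i * step + m) \<omega>)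
    \<le> real N * 1 * (2 * real d + real N * rho M X n k v)"
  proof (rule var_sum_le_of_weak_dependence)
    show sq: "integrable M (\<lambda>\<omega>. (calm v (i * step) (i * step + m) \<omega>)\<^sup>2)" for i
      using assms(1) by (intro integrable_bounded_square[where B = 1]) (auto simp: calm_bounds intro!: measurable_calm)
    fix i j assume ij: "i + d \<le> j" "j < N"
    have "i * step + 2 * m \<le> i * step + d * step" using sep by simp
    also have "\<dots> = (i + d) * step" by (simp add: algebra_simps)
    also have "\<dots> \<le> j * step" using ij by (intro mult_right_mono) auto
    finally have gap: "i * step + 2 * m \<le> j * step" .
    show "\<bar>cov M (calm v (i * step) (i * step + m)) (calm v (j * step) (j * step + m))\<bar>
      \<le> rho M X n k v * sqrt (var M (calm v (i * step) (i * step + m)) * var M (calm v (j * step) (j * step + m)))"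
      using gap assms(1,2) fits[OF ij(2)]
      by (intro cov_le_rho[OF calm_exceed_field calm_exceed_field sq sq]) auto
  qed (use assms(1) in \<open>auto intro!: measurable_calm var_calm_le_1 rho_nonneg\<close>)
  then show ?thesis by simp
qed

text \<open>
  The exceedances up to \<open>N\<close> are grouped into blocks of length \<open>m\<close>. Bounding the covariances of
  block counts rather than those of single exceedances keeps the clustering of exceedances inside
  a block out of the dependence bounds: it is measured by the second moment \<open>V\<close> instead.
\<close>

lemma var_sum_hit_le:
  assumes "1 \<le> m" "k \<le> m" "N \<le> n"
    and V: "expectation (\<lambda>\<omega>. (\<Sum>i<m. hit v i \<omega>)\<^sup>2) \<le> V"
  shows "var M (\<lambda>\<omega>. \<Sum>i<N. hit v i \<omega>)
    \<le> real (N div m + 1) * V * (4 + real (N div m + 1) * rho M X n k v)"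
proof -
  define b where "b = N div m + 1"
  \<comment> \<open>Cutting off at \<open>N\<close> makes all blocks equally long and keeps the last one within the range of \<open>rho\<close>.\<close>
  define e where "e i = (if i < N then hit v i else (\<lambda>_. 0))" for i
  define Y where "Y i \<omega> = (\<Sum>j\<in>{i * m..<i * m + m}. e j \<omega>)" for i \<omega>
  have e [measurable]: "e i \<in> borel_measurable M" for i
    unfolding e_def by simp
  have e_bounds: "0 \<le> e i \<omega>" "e i \<omega> \<le> 1" "e i \<omega> \<le> hit v i \<omega>" for i \<omega>
    unfolding e_def by (auto simp: hit_bounds)
  have Y [measurable]: "Y i \<in> borel_measurable M" for i
    unfolding Y_def by measurable
  have Y_nonneg: "0 \<le> Y i \<omega>" for i \<omega>
    unfolding Y_def by (intro sum_nonneg e_bounds)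
  have Y_le: "Y i \<omega> \<le> real m" for i \<omega>
    using sum_mono[of "{i * m..<i * m + m}" "\<lambda>j. e j \<omega>" "\<lambda>_. 1"] unfolding Y_def by (simp add: e_bounds)
  have Y2: "integrable M (\<lambda>\<omega>. (Y i \<omega>)\<^sup>2)" for i
    by (rule integrable_bounded_square[OF Y Y_nonneg Y_le])
  have Y_hit: "Y i \<omega> \<le> (\<Sum>j<m. hit v (i * m + j) \<omega>)" for i \<omega>
  proof -
    have "Y i \<omega> \<le> (\<Sum>j\<in>{i * m..<i * m + m}. hit v j \<omega>)"
      unfolding Y_def by (intro sum_mono e_bounds)
    also have "\<dots> = (\<Sum>j<m. hit v (i * m + j) \<omega>)"
      using sum.shift_bounds_nat_ivl[of "\<lambda>j. hit v j \<omega>" 0 "i * m" m]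
      by (simp add: add.commute lessThan_atLeast0)
    finally show ?thesis .
  qed
  have "N < b * m"
    using assms(1) dividend_less_div_times[of m N] unfolding b_def by (simp add: algebra_simps)
  have sum_Y: "(\<Sum>i<N. hit v i \<omega>) = (\<Sum>i<b. Y i \<omega>)" for \<omega>
  proof -
    have "(\<Sum>i<b. Y i \<omega>) = (\<Sum>j<b * m. e j \<omega>)"
      unfolding Y_def by (rule sum.nat_group)
    also have "\<dots> = (\<Sum>j<N. e j \<omega>)"
      using \<open>N < b * m\<close> by (intro sum.mono_neutral_right) (auto simp: e_def)
    also have "\<dots> = (\<Sum>j<N. hit v j \<omega>)"
      by (simp add: e_def)
    finally show ?thesis by simp
  qed
  have field: "Y i \<in> borel_measurable (exceed_field M X v (Suc (i * m)) (min (i * m + m) n))" for i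
  proof -
    have "e j \<in> borel_measurable (exceed_field M X v (Suc (i * m)) (min (i * m + m) n))"
      if "j \<in> {i * m..<i * m + m}" for j
    proof (cases "j < N")
      case True
      then show ?thesis using that \<open>N \<le> n\<close> by (auto simp: e_def intro!: hit_exceed_field)
    qed (simp add: e_def)
    then show ?thesis unfolding Y_def by (intro borel_measurable_sum)
  qed
  have "var M (\<lambda>\<omega>. \<Sum>i<b. Y i \<omega>) \<le> real b * V * (2 * real 2 + real b * rho M X n k v)"
  proof (rule var_sum_le_of_weak_dependence)
    fix i
    have "var M (Y i) \<le> expectation (\<lambda>\<omega>. (Y i \<omega>)\<^sup>2)"
      by (intro var_le_second_moment Y Y2)
    also have "\<dots> \<le> expectation (\<lambda>\<omega>. (\<Sum>j<m. hit v (i * m + j) \<omega>)\<^sup>2)"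
    proof (intro integral_mono Y2 power_mono Y_hit Y_nonneg)
      show "integrable M (\<lambda>\<omega>. (\<Sum>j<m. hit v (i * m + j) \<omega>)\<^sup>2)"
        using sum_mono[of "{..<m}" "\<lambda>j. hit v (i * m + j) _" "\<lambda>_. 1"]
        by (intro integrable_bounded_square[where B = "real m"]) (auto intro!: sum_nonneg simp: hit_bounds)
    qed
    finally show "var M (Y i) \<le> V"
      using V by (simp add: second_moment_block_count)
  next
    fix i j assume ij: "i + 2 \<le> j" "j < b"
    have "(i + 2) * m \<le> j * m" using ij by (intro mult_right_mono) auto
    then have gap: "i * m + 2 * m \<le> j * m" by (simp add: algebra_simps)
    have "j * m \<le> N div m * m" using ij by (intro mult_right_mono) (auto simp: b_def)
    then have "j * m \<le> n" using \<open>N \<le> n\<close> div_times_less_eq_dividend[of N m] by linarith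
    with gap assms(1,2) have "min (i * m + m) n = i * m + m" by simp
    with field[of i] have field_i: "Y i \<in> borel_measurable (exceed_field M X v (Suc (i * m)) (i * m + m))"
      by simp
    show "\<bar>cov M (Y i) (Y j)\<bar> \<le> rho M X n k v * sqrt (var M (Y i) * var M (Y j))"
      using gap \<open>j * m \<le> n\<close> assms(1,2)
      by (intro cov_le_rho[OF field_i field Y2 Y2]) auto
  next
    have "0 \<le> expectation (\<lambda>\<omega>. (\<Sum>i<m. hit v i \<omega>)\<^sup>2)" by simp
    then show "0 \<le> V" using V by linarith
  qed (auto intro: Y Y2 rho_nonneg)
  then show ?thesis
    unfolding sum_Y b_def by simp
qed

text \<open>
  The factor \<open>m * marginal_tail M X v\<close>, a union bound for an exceedance among \<open>m\<close> variables, is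
  what makes the second moment linear, not quadratic, in the length of the block.
\<close>

lemma second_moment_count_le:
  assumes "1 \<le> m"
    and "cond_expectation M (\<lambda>\<omega>. (real (exceedances X m v \<omega>))\<^sup>2) (\<lambda>\<omega>. block_max X 0 m \<omega> > v) \<le> K" "0 \<le> K"
  shows "expectation (\<lambda>\<omega>. (\<Sum>i<m. hit v i \<omega>)\<^sup>2) \<le> K * (real m * marginal_tail M X v)"
  unfolding second_moment_count_eq[OF assms(1)]
  using assms prob_block_max_gt_le[OF assms(1)] by (intro mult_mono) auto

subsection \<open>Means and variances of the three statistics\<close>

text \<open>
  Normalising \<open>var_sum_calm_le\<close> by \<open>1 / N\<close>; \<open>F_dj\<close> and \<open>F_sl\<close> are both such averages.
\<close>

lemma calm_average:
  assumes A: "A = (\<lambda>\<omega>. (\<Sum>i<N. calm v (i * step) (i * step + m) \<omega>) / real N)"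
    and "1 \<le> N" and "1 \<le> m" "k \<le> m" and step: "1 \<le> step" and sep: "2 * m \<le> d * step"
    and fits: "\<And>i. i < N \<Longrightarrow> i * step + m \<le> n"
  shows "A \<in> borel_measurable M" "integrable M (\<lambda>\<omega>. (A \<omega>)\<^sup>2)"
    and "expectation A = \<P>(\<omega> in M. block_max X 0 m \<omega> \<le> v)"
    and "var M A \<le> 2 * real d / real N + rho M X n k v"
proof -
  have [measurable]: "calm v (i * step) (i * step + m) \<in> borel_measurable M" for i
    using \<open>1 \<le> m\<close> by (intro measurable_calm) simp
  show meas: "A \<in> borel_measurable M" unfolding A by measurable
  have "(\<Sum>i<N. calm v (i * step) (i * step + m) \<omega>) \<le> real N" for \<omega>
    using sum_mono[of "{..<N}" "\<lambda>i. calm v (i * step) (i * step + m) \<omega>" "\<lambda>_. 1"]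
    by (simp add: calm_bounds)
  then show "integrable M (\<lambda>\<omega>. (A \<omega>)\<^sup>2)"
    using \<open>1 \<le> N\<close> by (intro integrable_bounded_square[OF meas, where B = 1])
      (auto simp: A divide_le_eq intro!: divide_nonneg_nonneg sum_nonneg calm_bounds)
  have "integrable M (calm v (i * step) (i * step + m))" for i
    by (rule integrable_const_bound[where B = 1]) (auto simp: calm_bounds)
  then show "expectation A = \<P>(\<omega> in M. block_max X 0 m \<omega> \<le> v)"
    unfolding A using \<open>1 \<le> N\<close> expectation_calm[OF \<open>1 \<le> m\<close>, of v]
    by (simp add: Bochner_Integration.integral_sum)
  have "var M A = var M (\<lambda>\<omega>. \<Sum>i<N. calm v (i * step) (i * step + m) \<omega>) / (real N)\<^sup>2"
    unfolding A by (rule var_divide)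
  also have "\<dots> \<le> real N * (2 * real d + real N * rho M X n k v) / (real N)\<^sup>2"
    using assms(3-7) by (intro divide_right_mono var_sum_calm_le) auto
  also have "\<dots> = 2 * real d / real N + rho M X n k v"
    using \<open>1 \<le> N\<close> by (simp add: power2_eq_square field_simps)
  finally show "var M A \<le> 2 * real d / real N + rho M X n k v" .
qed

lemma F_dj_eq:
  "F_dj X n m v = (\<lambda>\<omega>. (\<Sum>i<n div m. calm v (i * m) (i * m + m) \<omega>) / real (n div m))"
  unfolding F_dj_def[abs_def] calm_def One_nat_def sum.atLeast1_atMost_eq by (simp add: add.commute)

lemma F_sl_eq:
  "F_sl X n m v = (\<lambda>\<omega>. (\<Sum>i<n - m + 1. calm v (i * 1) (i * 1 + m) \<omega>) / real (n - m + 1))"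
  unfolding F_sl_def[abs_def] calm_def by (simp add: atLeast0AtMost lessThan_Suc_atMost)

lemma tau_hat_eq:
  "tau_hat X n m v = (\<lambda>\<omega>. (\<Sum>i<m * (n div m). hit v i \<omega>) / real (n div m))"
  unfolding tau_hat_def[abs_def] hit_def One_nat_def sum.atLeast1_atMost_eq by simp

lemma F_dj_moments:
  assumes "1 \<le> m" "k \<le> m" "m \<le> n"
  shows "F_dj X n m v \<in> borel_measurable M" "integrable M (\<lambda>\<omega>. (F_dj X n m v \<omega>)\<^sup>2)"
    and "expectation (F_dj X n m v) = \<P>(\<omega> in M. block_max X 0 m \<omega> \<le> v)"
    and "var M (F_dj X n m v) \<le> 8 * (real m / real n) + rho M X n k v"
proof -
  note N = le_twice_mult_div[OF assms(1,3)]
  have fits: "i * m + m \<le> n" if "i < n div m" for i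
  proof -
    have "Suc i * m \<le> n div m * m" using that by (intro mult_right_mono) auto
    then have "i * m + m \<le> n div m * m" by simp
    then show ?thesis using div_times_less_eq_dividend[of n m] by (rule order_trans)
  qed
  note avg = calm_average[OF F_dj_eq[of n m v] N(1) assms(1,2) assms(1) order_refl fits]
  show "F_dj X n m v \<in> borel_measurable M" "integrable M (\<lambda>\<omega>. (F_dj X n m v \<omega>)\<^sup>2)"
    and "expectation (F_dj X n m v) = \<P>(\<omega> in M. block_max X 0 m \<omega> \<le> v)"
    using avg(1-3) by simp_all
  have "2 * real 2 / real (n div m) \<le> 8 * (real m / real n)"
    using N assms by (simp add: field_simps)
  then show "var M (F_dj X n m v) \<le> 8 * (real m / real n) + rho M X n k v"
    using avg(4) by simp
qed

lemma F_sl_moments: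
  assumes "1 \<le> m" "k \<le> m" "2 * m \<le> n"
  shows "F_sl X n m v \<in> borel_measurable M" "integrable M (\<lambda>\<omega>. (F_sl X n m v \<omega>)\<^sup>2)"
    and "expectation (F_sl X n m v) = \<P>(\<omega> in M. block_max X 0 m \<omega> \<le> v)"
    and "var M (F_sl X n m v) \<le> 8 * (real m / real n) + rho M X n k v"
proof -
  have fits: "i * 1 + m \<le> n" if "i < n - m + 1" for i using that assms by simp
  have "2 * m \<le> (2 * m) * 1" by simp
  note avg = calm_average[OF F_sl_eq[of n m v] _ assms(1,2) order_refl this fits]
  show "F_sl X n m v \<in> borel_measurable M" "integrable M (\<lambda>\<omega>. (F_sl X n m v \<omega>)\<^sup>2)"
    and "expectation (F_sl X n m v) = \<P>(\<omega> in M. block_max X 0 m \<omega> \<le> v)"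
    using avg(1-3) by simp_all
  have "n \<le> 2 * (n - m + 1)"
    using assms by arith
  then have "real n \<le> real (2 * (n - m + 1))"
    by (simp only: of_nat_le_iff)
  then have "real n \<le> 2 * real (n - m + 1)"
    by (simp only: of_nat_mult of_nat_numeral)
  then have "real m * real n \<le> real m * (2 * real (n - m + 1))"
    by (intro mult_left_mono) auto
  moreover have "0 < real (n - m + 1)" "0 < real n"
    using assms by auto
  ultimately have "2 * real (2 * m) / real (n - m + 1) \<le> 8 * (real m / real n)"
    by (simp add: divide_le_eq le_divide_eq del: of_nat_add of_nat_Suc)
  then show "var M (F_sl X n m v) \<le> 8 * (real m / real n) + rho M X n k v"
    using avg(4) by simp
qed

text \<open>
  The blocks used here have the intermediate length \<open>s\<close>, not \<open>m\<close>. About \<open>n / s\<close> of them, each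
  with second moment at most \<open>K * s * marginal_tail M X v\<close>, give a variance of order
  \<open>n * marginal_tail M X v\<close> for the count, as long as \<open>n / s\<close> times \<open>rho\<close> stays bounded; dividing by
  the square of \<open>n div m\<close> leaves \<open>m / n\<close> times \<open>m * marginal_tail M X v\<close>.
\<close>

lemma tau_hat_moments:
  assumes "1 \<le> m" "m \<le> n" and s: "1 \<le> s" "k \<le> s" "s \<le> n"
    and K: "cond_expectation M (\<lambda>\<omega>. (real (exceedances X s v \<omega>))\<^sup>2) (\<lambda>\<omega>. block_max X 0 s \<omega> > v) \<le> K" "0 \<le> K"
  shows "tau_hat X n m v \<in> borel_measurable M" "integrable M (\<lambda>\<omega>. (tau_hat X n m v \<omega>)\<^sup>2)"
    and "expectation (tau_hat X n m v) = real m * marginal_tail M X v"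
    and "var M (tau_hat X n m v) \<le> 8 * K * (real m * marginal_tail M X v) * (real m / real n)
      * (4 + 2 * (rho M X n k v / (real s / real n)))"
proof -
  define N where "N = m * (n div m)"
  note blocks = le_twice_mult_div[OF assms(1,2)]
  have "N \<le> n" unfolding N_def by (metis times_div_less_eq_dividend)
  have eq: "tau_hat X n m v = (\<lambda>\<omega>. (\<Sum>i<N. hit v i \<omega>) / real (n div m))"
    unfolding tau_hat_eq N_def ..
  show meas: "tau_hat X n m v \<in> borel_measurable M" unfolding eq by measurable
  have "(\<Sum>i<N. hit v i \<omega>) \<le> real N" for \<omega>
    using sum_mono[of "{..<N}" "\<lambda>i. hit v i \<omega>" "\<lambda>_. 1"] by (simp add: hit_bounds)
  then show "integrable M (\<lambda>\<omega>. (tau_hat X n m v \<omega>)\<^sup>2)"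
    by (intro integrable_bounded_square[OF meas, where B = "real N / real (n div m)"])
      (auto simp: eq intro!: divide_right_mono divide_nonneg_nonneg sum_nonneg hit_bounds)
  have "integrable M (hit v i)" for i
    by (rule integrable_const_bound[where B = 1]) (auto simp: hit_bounds)
  then show "expectation (tau_hat X n m v) = real m * marginal_tail M X v"
    unfolding eq using blocks(1) by (simp add: Bochner_Integration.integral_sum expectation_hit N_def)
  let ?p = "marginal_tail M X v" and ?q = "rho M X n k v" and ?b = "real (N div s + 1)"
  have b: "?b \<le> 2 * real n / real s"
  proof -
    have "N div s \<le> n div s" using \<open>N \<le> n\<close> by (rule div_le_mono)
    then have "real (N div s) \<le> real n / real s"
      using of_nat_div_le_of_nat[of n s, where ?'a = real] by linarith
    moreover have "1 \<le> real n / real s" using s by simp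
    ultimately show ?thesis by simp
  qed
  have "0 \<le> ?p" "0 \<le> ?q" by (rule marginal_tail_nonneg, rule rho_nonneg)
  have "var M (tau_hat X n m v) = var M (\<lambda>\<omega>. \<Sum>i<N. hit v i \<omega>) / (real (n div m))\<^sup>2"
    unfolding eq by (rule var_divide)
  also have "\<dots> \<le> ?b * (K * (real s * ?p)) * (4 + ?b * ?q) / (real (n div m))\<^sup>2"
    using second_moment_count_le[OF s(1) K] \<open>N \<le> n\<close> s
    by (intro divide_right_mono var_sum_hit_le) auto
  also have "\<dots> \<le> (2 * real n / real s) * (K * (real s * ?p)) * (4 + (2 * real n / real s) * ?q)
      / (real n / (2 * real m))\<^sup>2"
    using b \<open>0 \<le> ?p\<close> \<open>0 \<le> ?q\<close> \<open>0 \<le> K\<close> blocks assms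
    by (intro frac_le mult_mono add_mono power_mono mult_nonneg_nonneg add_nonneg_nonneg)
      (auto simp: divide_le_eq mult.commute mult.left_commute)
  also have "\<dots> = 8 * K * (real m * ?p) * (real m / real n) * (4 + 2 * (?q / (real s / real n)))"
    using assms by (simp add: field_simps power2_eq_square)
  finally show "var M (tau_hat X n m v) \<le> 8 * K * (real m * ?p) * (real m / real n) * (4 + 2 * (?q / (real s / real n)))" .
qed

text \<open>
  The extremal index speaks of some sequence of levels \<open>v\<close> only, but \<open>prob_block_max_diff_le\<close> carries
  the limit over to every sequence with the same limiting expected number of exceedances.
\<close>

lemma prob_block_max_tendsto:
  assumes "has_extremal_index M X \<theta>" "\<tau> > 0"
    and u: "(\<lambda>m. real m * marginal_tail M X (u m)) \<longlonglongrightarrow> \<tau>"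
  shows "(\<lambda>m. \<P>(\<omega> in M. block_max X 0 m \<omega> \<le> u m)) \<longlonglongrightarrow> exp (- \<theta> * \<tau>)"
proof -
  from assms(1,2) obtain v where
    v: "(\<lambda>m. real m * marginal_tail M X (v m)) \<longlonglongrightarrow> \<tau>" and
    lim: "(\<lambda>m. \<P>(\<omega> in M. block_max X 0 m \<omega> \<le> v m)) \<longlonglongrightarrow> exp (- \<theta> * \<tau>)"
    unfolding has_extremal_index_def by blast
  have lim0: "(\<lambda>m. \<bar>real m * marginal_tail M X (u m) - real m * marginal_tail M X (v m)\<bar>) \<longlonglongrightarrow> 0"
    using tendsto_rabs_zero[of "\<lambda>m. real m * marginal_tail M X (u m) - real m * marginal_tail M X (v m)"]
      tendsto_diff[OF u v] by simp
  have "eventually (\<lambda>m. \<bar>\<P>(\<omega> in M. block_max X 0 m \<omega> \<le> u m) - \<P>(\<omega> in M. block_max X 0 m \<omega> \<le> v m)\<bar>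
      \<le> \<bar>real m * marginal_tail M X (u m) - real m * marginal_tail M X (v m)\<bar>) sequentially"
    using eventually_ge_at_top[of "1 :: nat"]
  proof eventually_elim
    case (elim m)
    then show ?case
      using prob_block_max_diff_le[OF elim, of "u m" "v m"]
      by (simp add: right_diff_distrib[symmetric] abs_mult)
  qed
  then have "eventually (\<lambda>m. norm (\<P>(\<omega> in M. block_max X 0 m \<omega> \<le> u m) - \<P>(\<omega> in M. block_max X 0 m \<omega> \<le> v m))
      \<le> \<bar>real m * marginal_tail M X (u m) - real m * marginal_tail M X (v m)\<bar>) sequentially"
    by (simp only: real_norm_def)
  then have "(\<lambda>m. \<P>(\<omega> in M. block_max X 0 m \<omega> \<le> u m) - \<P>(\<omega> in M. block_max X 0 m \<omega> \<le> v m)) \<longlonglongrightarrow> 0"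
    by (rule Lim_null_comparison[OF _ lim0])
  from tendsto_add[OF this lim] show ?thesis by simp
qed

end

section \<open>Consistency of the blocks estimators\<close>

theorem theorem4p1:
  fixes M :: "'a measure" and X :: "nat \<Rightarrow> 'a \<Rightarrow> real"
    and \<theta> \<tau> c :: real and u :: "nat \<Rightarrow> real"
    and r l s :: "nat \<Rightarrow> nat" and \<pi> :: "nat pmf"
  assumes "prob_space M"
    and "strictly_stationary M X"
    and "has_extremal_index M X \<theta>"
    and "\<tau> > 0"
    and "(\<lambda>m. real m * marginal_tail M X (u m)) \<longlonglongrightarrow> \<tau>"
    and "\<And>n. n \<ge> 1 \<Longrightarrow> r n > 0"
    and "\<And>n. n \<ge> 1 \<Longrightarrow> l n > 0"
    and "(\<lambda>n. real (l n)) \<in> o(\<lambda>n. real (r n))"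
    and "(\<lambda>n. real (r n)) \<in> o(\<lambda>n. real n)"
    and "(\<lambda>n. \<Sum>k=l n..n. rho M X n k (u (r n))) \<in> o(\<lambda>n. real (r n))"
    and "\<And>n. n \<ge> 1 \<Longrightarrow> s n > 0"
    and "0 \<notin> set_pmf \<pi>"
    and "(\<lambda>n. real (l n)) \<in> o(\<lambda>n. real (s n))"
    and "(\<lambda>n. real (s n)) \<in> o(\<lambda>n. real (r n))"
    and "(\<lambda>n. rho M X n (l n) (u (r n))) \<in> o(\<lambda>n. real (s n) / real n)"
    and "\<And>j. j \<ge> 1 \<Longrightarrow>
           (\<lambda>n. \<P>(\<omega> in M. exceedances X (s n) (u (r n)) \<omega> = j
                    \<bar> block_max X 0 (s n) \<omega> > u (r n))) \<longlonglongrightarrow> pmf \<pi> j"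
    and "summable (\<lambda>j. (real j)\<^sup>2 * pmf \<pi> j)"
    and "(\<lambda>n. cond_expectation M (\<lambda>\<omega>. (real (exceedances X (s n) (u (r n)) \<omega>))\<^sup>2)
                 (\<lambda>\<omega>. block_max X 0 (s n) \<omega> > u (r n)))
           \<longlonglongrightarrow> (\<Sum>j. (real j)\<^sup>2 * pmf \<pi> j)"
  shows "tendsto_in_prob M (\<lambda>n. theta_dj c X n (r n) (u (r n))) \<theta> \<and>
         tendsto_in_prob M (\<lambda>n. theta_sl c X n (r n) (u (r n))) \<theta>"
proof -
  interpret stationary_sequence M X
    using assms(1,2) by (intro stationary_sequence.intro stationary_sequence_axioms.intro)
  note ext = assms(3) and \<tau>_pos = assms(4) and tail = assms(5) and r_pos = assms(6) and l_pos = assms(7)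
    and l_r = assms(8) and r_n = assms(9) and s_pos = assms(11) and l_s = assms(13) and s_r = assms(14)
    and rho_s = assms(15) and cond_lim = assms(18)
  let ?v = "\<lambda>n. u (r n)" and ?q = "\<lambda>n. rho M X n (l n) (u (r n))"
  define K where "K = (\<Sum>j. (real j)\<^sup>2 * pmf \<pi> j) + 1"
  have lt_K: "(\<Sum>j. (real j)\<^sup>2 * pmf \<pi> j) < K"
    unfolding K_def by simp
  have "0 \<le> K"
    unfolding K_def using suminf_nonneg[OF assms(17)] by simp

  \<comment> \<open>A block length that dominates \<open>l n \<ge> 1\<close> must be unbounded.\<close>
  have r_at_top: "filterlim r at_top sequentially"
    unfolding filterlim_at_top
  proof
    fix Z :: nat
    have "eventually (\<lambda>n. \<bar>real (l n)\<bar> \<le> 1 / (real Z + 1) * \<bar>real (r n)\<bar>) sequentially"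
      using landau_o.smallD[OF l_r, of "1 / (real Z + 1)"] by simp
    then show "eventually (\<lambda>n. Z \<le> r n) sequentially"
      using eventually_ge_at_top[of "1 :: nat"]
    proof eventually_elim
      case (elim n)
      have "real Z + 1 \<le> (real Z + 1) * real (l n)"
        using l_pos[OF elim(2)] by simp
      also have "\<dots> \<le> real (r n)"
        using elim(1) by (simp add: field_simps)
      finally show "Z \<le> r n" by linarith
    qed
  qed

  have ratio: "(\<lambda>n. real (r n) / real n) \<longlonglongrightarrow> 0"
    by (rule smalloD_tendsto[OF r_n])
  have rho_ratio: "(\<lambda>n. ?q n / (real (s n) / real n)) \<longlonglongrightarrow> 0"
    by (rule smalloD_tendsto[OF rho_s])
  have mean_tail: "(\<lambda>n. real (r n) * marginal_tail M X (?v n)) \<longlonglongrightarrow> \<tau>"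
    using filterlim_compose[OF tail r_at_top] .

  have regime: "eventually (\<lambda>n. 1 \<le> r n \<and> 1 \<le> s n \<and> l n \<le> s n \<and> s n \<le> r n \<and> 2 * r n \<le> n \<and>
      cond_expectation M (\<lambda>\<omega>. (real (exceedances X (s n) (?v n) \<omega>))\<^sup>2)
        (\<lambda>\<omega>. block_max X 0 (s n) \<omega> > ?v n) \<le> K) sequentially"
    using eventually_ge_at_top[of "1 :: nat"] landau_o.smallD[OF l_s zero_less_one]
      landau_o.smallD[OF s_r zero_less_one] landau_o.smallD[OF r_n half_gt_zero[OF zero_less_one]]
      order_tendstoD(2)[OF cond_lim lt_K]
  proof eventually_elim
    case (elim n)
    then show ?case
      using r_pos[of n] s_pos[of n] by (auto simp: Suc_le_eq)
  qed

  have rho_lim: "?q \<longlonglongrightarrow> 0"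
  proof (rule tendsto_sandwich[OF _ _ tendsto_const rho_ratio])
    show "eventually (\<lambda>n. ?q n \<le> ?q n / (real (s n) / real n)) sequentially"
      using regime
    proof eventually_elim
      case (elim n)
      then have "s n \<le> n" "0 < s n" by linarith+
      then have "?q n * real (s n) \<le> ?q n * real n"
        by (intro mult_left_mono rho_nonneg) simp
      then show ?case using \<open>0 < s n\<close> by (simp add: field_simps)
    qed
  qed (simp add: rho_nonneg)

  have calm_lim: "(\<lambda>n. \<P>(\<omega> in M. block_max X 0 (r n) \<omega> \<le> ?v n)) \<longlonglongrightarrow> exp (- \<theta> * \<tau>)"
    using filterlim_compose[OF prob_block_max_tendsto[OF ext \<tau>_pos tail] r_at_top] .
  have F_var: "(\<lambda>n. 8 * (real (r n) / real n) + ?q n) \<longlonglongrightarrow> 0"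
    using tendsto_add[OF tendsto_mult_right_zero[OF ratio, of 8] rho_lim] by simp

  have F_consistent: "eventually (\<lambda>n. F n \<in> borel_measurable M) sequentially"
      "tendsto_in_prob M F (exp (- \<theta> * \<tau>))"
    if moments: "eventually (\<lambda>n. F n \<in> borel_measurable M \<and> integrable M (\<lambda>\<omega>. (F n \<omega>)\<^sup>2) \<and>
      expectation (F n) = \<P>(\<omega> in M. block_max X 0 (r n) \<omega> \<le> ?v n) \<and>
      var M (F n) \<le> 8 * (real (r n) / real n) + ?q n) sequentially" for F
  proof -
    show meas: "eventually (\<lambda>n. F n \<in> borel_measurable M) sequentially"
      using moments by eventually_elim blast
    show "tendsto_in_prob M F (exp (- \<theta> * \<tau>))"
    proof (rule tendsto_in_prob_of_moments[OF \<open>prob_space M\<close> meas])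
      show "eventually (\<lambda>n. integrable M (\<lambda>\<omega>. (F n \<omega>)\<^sup>2)) sequentially"
        using moments by eventually_elim blast
      have "eventually (\<lambda>n. \<P>(\<omega> in M. block_max X 0 (r n) \<omega> \<le> ?v n) = expectation (F n)) sequentially"
        using moments by eventually_elim simp
      then show "(\<lambda>n. expectation (F n)) \<longlonglongrightarrow> exp (- \<theta> * \<tau>)"
        by (rule Lim_transform_eventually[OF calm_lim])
      have "eventually (\<lambda>n. var M (F n) \<le> 8 * (real (r n) / real n) + ?q n) sequentially"
        using moments by eventually_elim blast
      then show "(\<lambda>n. var M (F n)) \<longlonglongrightarrow> 0"
        by (rule tendsto_sandwich[OF always_eventually[OF allI[OF var_nonneg]] _ tendsto_const F_var])
    qed
  qed
  have dj_moments: "eventually (\<lambda>n. F_dj X n (r n) (?v n) \<in> borel_measurable M \<and>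
      integrable M (\<lambda>\<omega>. (F_dj X n (r n) (?v n) \<omega>)\<^sup>2) \<and>
      expectation (F_dj X n (r n) (?v n)) = \<P>(\<omega> in M. block_max X 0 (r n) \<omega> \<le> ?v n) \<and>
      var M (F_dj X n (r n) (?v n)) \<le> 8 * (real (r n) / real n) + ?q n) sequentially"
    using regime
  proof eventually_elim
    case (elim n)
    then have "1 \<le> r n" "l n \<le> r n" "r n \<le> n" by linarith+
    from F_dj_moments[OF this, of "?v n"] show ?case by blast
  qed
  have sl_moments: "eventually (\<lambda>n. F_sl X n (r n) (?v n) \<in> borel_measurable M \<and>
      integrable M (\<lambda>\<omega>. (F_sl X n (r n) (?v n) \<omega>)\<^sup>2) \<and>
      expectation (F_sl X n (r n) (?v n)) = \<P>(\<omega> in M. block_max X 0 (r n) \<omega> \<le> ?v n) \<and>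
      var M (F_sl X n (r n) (?v n)) \<le> 8 * (real (r n) / real n) + ?q n) sequentially"
    using regime
  proof eventually_elim
    case (elim n)
    then have "1 \<le> r n" "l n \<le> r n" "2 * r n \<le> n" by linarith+
    from F_sl_moments[OF this, of "?v n"] show ?case by blast
  qed

  have tau_moments: "eventually (\<lambda>n. tau_hat X n (r n) (?v n) \<in> borel_measurable M \<and>
      integrable M (\<lambda>\<omega>. (tau_hat X n (r n) (?v n) \<omega>)\<^sup>2) \<and>
      expectation (tau_hat X n (r n) (?v n)) = real (r n) * marginal_tail M X (?v n) \<and>
      var M (tau_hat X n (r n) (?v n)) \<le> 8 * K * (real (r n) * marginal_tail M X (?v n)) * (real (r n) / real n)
        * (4 + 2 * (?q n / (real (s n) / real n)))) sequentially"
    using regime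
  proof eventually_elim
    case (elim n)
    then have "1 \<le> r n" "r n \<le> n" "1 \<le> s n" "l n \<le> s n" "s n \<le> n" by linarith+
    note moments = tau_hat_moments[OF this _ \<open>0 \<le> K\<close>, of "?v n"]
    show ?case using moments elim by blast
  qed
  then have tau_meas: "eventually (\<lambda>n. tau_hat X n (r n) (?v n) \<in> borel_measurable M) sequentially"
    by eventually_elim blast
  have tau: "tendsto_in_prob M (\<lambda>n. tau_hat X n (r n) (?v n)) \<tau>"
  proof (rule tendsto_in_prob_of_moments[OF \<open>prob_space M\<close> tau_meas])
    show "eventually (\<lambda>n. integrable M (\<lambda>\<omega>. (tau_hat X n (r n) (?v n) \<omega>)\<^sup>2)) sequentially"
      using tau_moments by eventually_elim blast
    have "eventually (\<lambda>n. real (r n) * marginal_tail M X (?v n) = expectation (tau_hat X n (r n) (?v n))) sequentially"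
      using tau_moments by eventually_elim simp
    then show "(\<lambda>n. expectation (tau_hat X n (r n) (?v n))) \<longlonglongrightarrow> \<tau>"
      by (rule Lim_transform_eventually[OF mean_tail])
    have "(\<lambda>n. 8 * K * (real (r n) * marginal_tail M X (?v n)) * (real (r n) / real n)
        * (4 + 2 * (?q n / (real (s n) / real n)))) \<longlonglongrightarrow> 8 * K * \<tau> * 0 * (4 + 2 * 0)"
      by (intro tendsto_mult tendsto_add tendsto_const mean_tail ratio rho_ratio)
    then have bound_lim: "(\<lambda>n. 8 * K * (real (r n) * marginal_tail M X (?v n)) * (real (r n) / real n)
        * (4 + 2 * (?q n / (real (s n) / real n)))) \<longlonglongrightarrow> 0"
      by simp
    show "(\<lambda>n. var M (tau_hat X n (r n) (?v n))) \<longlonglongrightarrow> 0"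
    proof (rule tendsto_sandwich[OF _ _ tendsto_const bound_lim])
      show "eventually (\<lambda>n. var M (tau_hat X n (r n) (?v n)) \<le> 8 * K * (real (r n) * marginal_tail M X (?v n))
          * (real (r n) / real n) * (4 + 2 * (?q n / (real (s n) / real n)))) sequentially"
        using tau_moments by eventually_elim blast
    qed (simp add: var_nonneg)
  qed

  have limit_value: "- (ln (exp (- \<theta> * \<tau>)) / \<tau>) = \<theta>"
    using \<tau>_pos by simp
  show ?thesis
  proof
    show "tendsto_in_prob M (\<lambda>n. theta_dj c X n (r n) (?v n)) \<theta>"
      using log_ratio_tendsto_in_prob[OF \<open>prob_space M\<close> F_consistent(2)[OF dj_moments] tau exp_gt_zero \<tau>_pos
        F_consistent(1)[OF dj_moments] tau_meas theta_dj_def]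
      unfolding limit_value .
    show "tendsto_in_prob M (\<lambda>n. theta_sl c X n (r n) (?v n)) \<theta>"
      using log_ratio_tendsto_in_prob[OF \<open>prob_space M\<close> F_consistent(2)[OF sl_moments] tau exp_gt_zero \<tau>_pos
        F_consistent(1)[OF sl_moments] tau_meas theta_sl_def]
      unfolding limit_value .
  qed
qed

end
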